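(* There is an absolute constant $C>0$ such that the following holds. Let $x_1,\dots,x_n\in\mathbb{R}^d$, let $\gamma>0$, and let each $l_j:\mathbb{R}\to\mathbb{R}$ be a convex quadratic loss (e.g. $l_j(z)=\frac12(z-y_j)^2$), so that the Hessian of $F(w)=\frac1n\sum_{j=1}^n l_j(x_j^Tw)+\frac{\gamma}{2}\|w\|_2^2$ is a constant matrix $H=\frac1n A^TA+\gamma I_d$, where $A\in\mathbb{R}^{n\times d}$ has $j$-th row $\sqrt{l_j''}\,x_j^T$. Let $d_{\mathrm{eff}}^\gamma$ and $\mu^\gamma$ be the $\gamma$-effective dimension and the row $\gamma$-ridge coherence of $A$, let $\kappa=\sigma_{\max}(H)/\sigma_{\min}(H)$, and let $w^\star$ be the unique minimizer of $F$. Let $\varepsilon\in(0,\frac14)$ and $\delta\in(0,1)$, and let the sub-sample size $s$ satisfy $$ s\ \ge\ C\,\frac{\mu^\gamma d_{\mathrm{eff}}^\gamma}{\varepsilon^2}\log\frac{d_{\mathrm{eff}}^\gamma}{\delta}. $$ Let $w_0\in\mathbb{R}^d$ and let $(w_t)_{t\ge0}$ be the iterates of the Sub-Sampled Newton method with uniform sampling, $w_{t+1}=w_t-\widetilde H^{-1}\nabla F(w_t)$, where $\widetilde H=\frac1s\widetilde A^T\widetilde A+\gamma I_d$ and $\widetilde A\in\mathbb{R}^{s\times d}$ consists of $s$ uniformly sampled rows of $A$. Then, with probability at least $1-\delta$ over the sampling, for all $t\ge 0$, $$ \|w_t-w^\star\|_2\ \le\ \varepsilon^t\sqrt{\kappa}\,\|w_0-w^\star\|_2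 . $$
   Context: For $A=[a_1^T;\dots;a_n^T]\in\mathbb{R}^{n\times d}$ and $\gamma\ge0$, the row $\gamma$-ridge leverage scores are $l_j^\gamma=a_j^T(A^TA+n\gamma I_d)^\dagger a_j$, $j=1,\dots,n$. The $\gamma$-effective dimension is $d_{\mathrm{eff}}^\gamma(A)=\sum_{j=1}^n l_j^\gamma=\sum_{k=1}^d\frac{\sigma_k^2}{\sigma_k^2+n\gamma}$, where $\sigma_1,\dots,\sigma_d$ are the singular values of $A$. The row $\gamma$-ridge coherence is $\mu^\gamma(A)=\frac{n}{d_{\mathrm{eff}}^\gamma}\max_{i}l_i^\gamma$. Uniform sampling: $s$ row indices are drawn independently and uniformly from $\{1,\dots,n\}$; $\widetilde A$ consists of the corresponding rows of $A$. The sampled index set is drawn once and used in all iterations. $\sigma_{\max},\sigma_{\min}$ denote largest and smallest singular values.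
   Formalization: The logarithm log(d_eff/δ) in the condition on s is replaced by max(1, log(d_eff/δ)): with the bare logarithm the condition is void for d_eff ≤ δ (and nearly void for d_eff slightly above δ), and the claim then fails for every C. *)

theory Defs
  imports
    "HOL-Probability.Probability"
    "Jordan_Normal_Form.Spectral_Radius"
begin

(* The dimensions n, d and s have to range inside the scope of the absolute constant C. Hence
   matrices and vectors are those of Jordan_Normal_Form (explicit carriers), and not
   the type-indexed ones of HOL-Analysis, whose notation is disabled here. *)
unbundle no inner_syntax
unbundle no vec_syntax
hide_const (open) Finite_Cartesian_Product.mat Finite_Cartesian_Product.vec
  Finite_Cartesian_Product.row Finite_Cartesian_Product.vec_nth
hide_type (open) Finite_Cartesian_Product.vec

definition norm2 :: "real vec \<Rightarrow> real" where
  "norm2 v = sqrt (v \<bullet> v)"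

(* The four Penrose conditions; over the reals the conjugate transpose is the transpose. *)
definition is_pseudoinverse :: "real mat \<Rightarrow> real mat \<Rightarrow> bool" where
  "is_pseudoinverse M X \<longleftrightarrow>
     X \<in> carrier_mat (dim_col M) (dim_row M) \<and>
     M * X * M = M \<and> X * M * X = X \<and>
     transpose_mat (M * X) = M * X \<and> transpose_mat (X * M) = X * M"

definition pseudoinverse :: "real mat \<Rightarrow> real mat" where
  "pseudoinverse M = (THE X. is_pseudoinverse M X)"

(* One singular value for each eigenvalue of M^T M, i.e. dim_col M of them up to multiplicity
   (the multiplicities are irrelevant for the largest and the smallest one). *)
definition singular_values :: "real mat \<Rightarrow> real set" where
  "singular_values M = sqrt ` spectrum (transpose_mat M * M)"

definition cond_number :: "real mat \<Rightarrow> real" where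
  "cond_number M = Max (singular_values M) / Min (singular_values M)"

(* In the next three definitions n is the number of rows of A; rows are numbered from 0. *)
definition ridge_leverage :: "real \<Rightarrow> real mat \<Rightarrow> nat \<Rightarrow> real" where
  "ridge_leverage \<gamma> A j =
     row A j \<bullet> (pseudoinverse (transpose_mat A * A +
                   (real (dim_row A) * \<gamma>) \<cdot>\<^sub>m 1\<^sub>m (dim_col A)) *\<^sub>v row A j)"

definition eff_dim :: "real \<Rightarrow> real mat \<Rightarrow> real" where
  "eff_dim \<gamma> A = (\<Sum>j<dim_row A. ridge_leverage \<gamma> A j)"

definition ridge_coherence :: "real \<Rightarrow> real mat \<Rightarrow> real" where
  "ridge_coherence \<gamma> A =
     real (dim_row A) / eff_dim \<gamma> A * Max (ridge_leverage \<gamma> A ` {..<dim_row A})"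

definition convex_quadratic :: "(real \<Rightarrow> real) \<Rightarrow> bool" where
  "convex_quadratic l \<longleftrightarrow>
     convex_on UNIV l \<and> (\<exists>a b c. \<forall>z. l z = a * z\<^sup>2 + b * z + c)"

definition objective ::
    "nat \<Rightarrow> (nat \<Rightarrow> real vec) \<Rightarrow> (nat \<Rightarrow> real \<Rightarrow> real) \<Rightarrow> real \<Rightarrow> real vec \<Rightarrow> real" where
  "objective n x l \<gamma> w = 1 / real n * (\<Sum>j<n. l j (x j \<bullet> w)) + \<gamma> / 2 * (norm2 w)\<^sup>2"

definition grad :: "nat \<Rightarrow> (real vec \<Rightarrow> real) \<Rightarrow> real vec \<Rightarrow> real vec" where
  "grad d F w = vec d (\<lambda>i. deriv (\<lambda>h. F (w + h \<cdot>\<^sub>v unit_vec d i)) 0)"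

definition hessian :: "nat \<Rightarrow> (real vec \<Rightarrow> real) \<Rightarrow> real vec \<Rightarrow> real mat" where
  "hessian d F w =
     mat d d (\<lambda>(i, k). deriv (\<lambda>h. vec_index (grad d F (w + h \<cdot>\<^sub>v unit_vec d k)) i) 0)"

(* The second derivative of a quadratic loss is constant, so the point 0 is arbitrary. *)
definition data_mat ::
    "nat \<Rightarrow> nat \<Rightarrow> (nat \<Rightarrow> real vec) \<Rightarrow> (nat \<Rightarrow> real \<Rightarrow> real) \<Rightarrow> real mat" where
  "data_mat n d x l = mat_of_rows d (map (\<lambda>j. sqrt (deriv (deriv (l j)) 0) \<cdot>\<^sub>v x j) [0..<n])"

(* For m = dim_row B this is (1/m) B^T B + gamma I. It yields both H, from B = A, and the
   sub-sampled Hessian, from the sampled rows of A. The latter are not rescaled: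
   for uniform sampling the factor 1/m accounts for that. *)
definition ridge_hessian :: "real \<Rightarrow> real mat \<Rightarrow> real mat" where
  "ridge_hessian \<gamma> B =
     (1 / real (dim_row B)) \<cdot>\<^sub>m (transpose_mat B * B) + \<gamma> \<cdot>\<^sub>m 1\<^sub>m (dim_col B)"

definition sample_rows :: "real mat \<Rightarrow> nat \<Rightarrow> (nat \<Rightarrow> nat) \<Rightarrow> real mat" where
  "sample_rows A s \<omega> = mat_of_rows (dim_col A) (map (\<lambda>k. row A (\<omega> k)) [0..<s])"

(* s independent uniform draws (with replacement) from {0..<n}; the coordinates k >= s are not
   used and have the fixed value 0. *)
definition uniform_sampling :: "nat \<Rightarrow> nat \<Rightarrow> (nat \<Rightarrow> nat) pmf" where
  "uniform_sampling n s = Pi_pmf {..<s} 0 (\<lambda>_. pmf_of_set {..<n})"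

(* Newton iteration with a fixed approximate Hessian M. mat_inverse returns Some exactly for
   invertible square matrices. *)
primrec newton_iter ::
    "nat \<Rightarrow> (real vec \<Rightarrow> real) \<Rightarrow> real mat \<Rightarrow> real vec \<Rightarrow> nat \<Rightarrow> real vec" where
  "newton_iter d F M w0 0 = w0"
| "newton_iter d F M w0 (Suc t) =
     newton_iter d F M w0 t - the (mat_inverse M) *\<^sub>v grad d F (newton_iter d F M w0 t)"

end

theory Submission
  imports Defs
begin

text \<open>
  If the sub-sampled Hessian approximates \<open>H\<close> up to a relative error \<open>\<epsilon> / 2\<close> as a quadratic form,
  one Newton step contracts the energy norm of \<open>H\<close> by the factor \<open>\<epsilon>\<close>; passing to the Euclidean norm
  costs \<open>\<surd>\<kappa>\<close> once. Write \<open>H = B\<^sup>T B\<close> and \<open>z\<^sub>j = B H\<inverse> a\<^sub>j\<close>. The approximation then says that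
  the empirical mean of the matrices \<open>z\<^sub>j z\<^sub>j\<^sup>T\<close> deviates from the population mean \<open>\<Sigma>\<close> by a
  matrix \<open>X\<close> of norm at most \<open>\<epsilon> / 2\<close>, where \<open>\<Sigma> \<le> I\<close>, \<open>tr \<Sigma> = d\<^sub>e\<^sub>f\<^sub>f\<close> and
  \<open>\<parallel>z\<^sub>j\<parallel>\<^sup>2 = n l\<^sub>j \<le> M := \<mu> d\<^sub>e\<^sub>f\<^sub>f\<close>.

  The tail of \<open>X\<close> is bounded by the method of exchangeable pairs: redrawing one sample gives
  \<open>E tr X\<^sup>2\<^sup>q \<le> 2 (2q - 1) (M / s) E tr ((X + 2 \<Sigma>) X\<^sup>2\<^sup>q\<^sup>-\<^sup>2)\<close>. Since \<open>\<Sigma> \<le> I\<close>, this is a recursion in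
  \<open>q\<close>, and it starts from \<open>tr \<Sigma>\<close> rather than from the dimension; hence
  \<open>E tr X\<^sup>2\<^sup>p \<le> (20 p M / s)\<^sup>p d\<^sub>e\<^sub>f\<^sub>f\<close> as long as \<open>4 p M \<le> s\<close>. Markov's inequality with \<open>p\<close> close to
  \<open>max 1 (ln (d\<^sub>e\<^sub>f\<^sub>f / \<delta>))\<close> concludes.
\<close>

section \<open>Trace inequalities for symmetric matrices\<close>

definition trace_mat :: "real mat \<Rightarrow> real" where
  "trace_mat A = (\<Sum>i<dim_row A. A $$ (i, i))"

lemma trace_mat_add:
  "A \<in> carrier_mat N N \<Longrightarrow> B \<in> carrier_mat N N \<Longrightarrow> trace_mat (A + B) = trace_mat A + trace_mat B"
  by (simp add: trace_mat_def sum.distrib)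

lemma trace_mat_minus:
  "A \<in> carrier_mat N N \<Longrightarrow> B \<in> carrier_mat N N \<Longrightarrow> trace_mat (A - B) = trace_mat A - trace_mat B"
  by (simp add: trace_mat_def sum_subtractf)

lemma trace_mat_smult: "A \<in> carrier_mat N N \<Longrightarrow> trace_mat (c \<cdot>\<^sub>m A) = c * trace_mat A"
  by (simp add: trace_mat_def sum_distrib_left)

lemma trace_mat_mult:
  assumes "A \<in> carrier_mat N K" "B \<in> carrier_mat K N"
  shows "trace_mat (A * B) = (\<Sum>i<N. \<Sum>k<K. A $$ (i, k) * B $$ (k, i))"
  using assms unfolding trace_mat_def
  by (auto simp: scalar_prod_def atLeast0LessThan intro!: sum.cong)

lemma trace_mat_comm:
  assumes "A \<in> carrier_mat N K" "B \<in> carrier_mat K N"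
  shows "trace_mat (A * B) = trace_mat (B * A)"
  unfolding trace_mat_mult[OF assms] trace_mat_mult[OF assms(2,1)]
  by (subst sum.swap) (simp add: mult.commute)

lemma trace_transpose_mult:
  assumes "A \<in> carrier_mat K N" "B \<in> carrier_mat K N"
  shows "trace_mat (transpose_mat A * B) = (\<Sum>i<N. \<Sum>k<K. A $$ (k, i) * B $$ (k, i))"
  using assms by (subst trace_mat_mult[where N = N and K = K]) auto

lemma trace_transpose_mult_self_nonneg:
  assumes "A \<in> carrier_mat K N"
  shows "0 \<le> trace_mat (transpose_mat A * A)"
  unfolding trace_transpose_mult[OF assms assms] by (intro sum_nonneg) simp

text \<open>The bound \<open>2 x y \<le> x^2 + y^2\<close>, entry by entry: Cauchy--Schwarz for the
  Frobenius inner product in a form without square roots.\<close>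

lemma trace_transpose_mult_le:
  assumes "A \<in> carrier_mat K N" "B \<in> carrier_mat K N"
  shows "2 * trace_mat (transpose_mat A * B)
    \<le> trace_mat (transpose_mat A * A) + trace_mat (transpose_mat B * B)"
proof -
  have "2 * (x * y) \<le> x * x + y * y" for x y :: real
    using zero_le_power2[of "x - y"] by (simp add: power2_eq_square algebra_simps)
  then have "(\<Sum>i<N. \<Sum>k<K. 2 * (A $$ (k, i) * B $$ (k, i)))
      \<le> (\<Sum>i<N. \<Sum>k<K. A $$ (k, i) * A $$ (k, i) + B $$ (k, i) * B $$ (k, i))"
    by (intro sum_mono)
  then show ?thesis
    unfolding trace_transpose_mult[OF assms] trace_transpose_mult[OF assms(1,1)]
      trace_transpose_mult[OF assms(2,2)]
    by (simp only: sum.distrib sum_distrib_left)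
qed

text \<open>With a single dimension, fixed at each use by \<open>[of _ N]\<close>, associativity
  becomes a rewrite rule whose carrier premises leave no dimension to be guessed.\<close>

lemma assoc_mult_square_mat:
  "A \<in> carrier_mat N N \<Longrightarrow> B \<in> carrier_mat N N \<Longrightarrow> C \<in> carrier_mat N N \<Longrightarrow> A * B * C = A * (B * C)"
  by (rule assoc_mult_mat)

lemma mult_square_carrier_mat:
  "A \<in> carrier_mat N N \<Longrightarrow> B \<in> carrier_mat N N \<Longrightarrow> A * B \<in> carrier_mat N N"
  by (rule mult_carrier_mat)

section \<open>Powers of symmetric matrices\<close>

lemma pow_mat_add:
  assumes X: "X \<in> carrier_mat N N"
  shows "X ^\<^sub>m (i + j) = X ^\<^sub>m i * X ^\<^sub>m j"
proof (induction j)
  case (Suc j)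
  then show ?case using X by (simp add: assoc_mult_square_mat[of _ N])
qed (use X in auto)

lemma transpose_pow_mat:
  fixes X :: "'a :: comm_semiring_1 mat"
  assumes X: "X \<in> carrier_mat N N" and "transpose_mat X = X"
  shows "transpose_mat (X ^\<^sub>m i) = X ^\<^sub>m i"
proof (induction i)
  case (Suc i)
  have "X ^\<^sub>m i * X = X * X ^\<^sub>m i"
    using pow_mat_add[OF X, of 1 i] pow_mat_add[OF X, of i 1] X by simp
  with Suc show ?case
    using assms transpose_mult[of "X ^\<^sub>m i" N N X N] by simp
qed (use X in simp)

text \<open>At the least index where the maximum over \<open>{..r}\<close> is attained, the left
  neighbour is strictly smaller; midpoint convexity therefore rules out an interior index.\<close>

lemma midpoint_convex_le_ends:
  fixes g :: "nat \<Rightarrow> real"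
  assumes convex: "\<And>a. 0 < a \<Longrightarrow> a < r \<Longrightarrow> 2 * g a \<le> g (a - 1) + g (a + 1)" and "a \<le> r"
  shows "g a \<le> max (g 0) (g r)"
proof -
  define m where "m = Max (g ` {..r})"
  have le_m: "g b \<le> m" if "b \<le> r" for b
    unfolding m_def using that by (intro Max_ge) auto
  have "m \<in> g ` {..r}"
    unfolding m_def by (rule Max_in) auto
  then have ex: "\<exists>b. b \<le> r \<and> g b = m" by auto
  define b where "b = (LEAST b. b \<le> r \<and> g b = m)"
  have b: "b \<le> r" "g b = m"
    using LeastI_ex[OF ex] unfolding b_def by auto
  have less: "g c < m" if "c < b" for c
    using not_less_Least[of c "\<lambda>b. b \<le> r \<and> g b = m"] that b(1) le_m[of c]
    unfolding b_def[symmetric] by fastforce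
  have "b = 0 \<or> b = r"
  proof (rule ccontr)
    assume "\<not> ?thesis"
    then have "0 < b" "b < r" using b(1) by auto
    with convex[of b] less[of "b - 1"] le_m[of "b + 1"] b(2) show False by auto
  qed
  with le_m[OF \<open>a \<le> r\<close>] b(2) show ?thesis by auto
qed

text \<open>As a function of \<open>i\<close>, the trace on the left is midpoint-convex on even numbers, by the
  Cauchy--Schwarz inequality for the Frobenius inner product.\<close>

lemma trace_interpolation:
  assumes D: "D \<in> carrier_mat N N" "transpose_mat D = D"
    and X: "X \<in> carrier_mat N N" "transpose_mat X = X"
    and Y: "Y \<in> carrier_mat N N" "transpose_mat Y = Y"
    and "i \<le> 2 * r"
  shows "trace_mat (D * X ^\<^sub>m i * D * Y ^\<^sub>m (2 * r - i))
    \<le> trace_mat (D * D * Y ^\<^sub>m (2 * r)) + trace_mat (D * D * X ^\<^sub>m (2 * r))"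
proof -
  define h where "h i = trace_mat (D * X ^\<^sub>m i * D * Y ^\<^sub>m (2 * r - i))" for i
  \<comment> \<open>The exponent of \<open>Y\<close> complements that of \<open>X\<close>, so that
    the Frobenius inner product of \<open>U a\<close> and \<open>U b\<close> depends on
    \<open>a + b\<close> only.\<close>
  define U where "U a = X ^\<^sub>m a * D * Y ^\<^sub>m (r - a)" for a
  have U: "U a \<in> carrier_mat N N" for a
    unfolding U_def using D X Y by (simp add: mult_square_carrier_mat)
  note [simp] = D X Y mult_square_carrier_mat assoc_mult_square_mat[of _ N] transpose_mult[of _ N N _ N]
    transpose_pow_mat[of _ N]
  have trace_U: "trace_mat (transpose_mat (U a) * U b) = h (a + b)" if "a \<le> r" "b \<le> r" for a b
  proof -
    have "transpose_mat (U a) * U b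
        = Y ^\<^sub>m (r - a) * (D * X ^\<^sub>m (a + b) * D * Y ^\<^sub>m (r - b))"
      unfolding U_def by (simp add: pow_mat_add[of X N])
    moreover have "trace_mat \<dots> = trace_mat ((D * X ^\<^sub>m (a + b) * D * Y ^\<^sub>m (r - b)) * Y ^\<^sub>m (r - a))"
      by (rule trace_mat_comm[of _ N N]) simp_all
    moreover have "(D * X ^\<^sub>m (a + b) * D * Y ^\<^sub>m (r - b)) * Y ^\<^sub>m (r - a)
        = D * X ^\<^sub>m (a + b) * D * Y ^\<^sub>m ((r - b) + (r - a))"
      unfolding pow_mat_add[OF Y(1)] by simp
    moreover have "r - b + (r - a) = 2 * r - (a + b)" using that by simp
    ultimately show ?thesis unfolding h_def by simp
  qed
  have mid: "2 * h (a + b) \<le> h (2 * a) + h (2 * b)" if "a \<le> r" "b \<le> r" for a b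
    using trace_transpose_mult_le[OF U[of a] U[of b]]
    unfolding trace_U[OF that] trace_U[OF that(1,1)] trace_U[OF that(2,2)] mult_2[symmetric] .
  have nonneg: "0 \<le> h (2 * a)" if "a \<le> r" for a
    using trace_transpose_mult_self_nonneg[OF U[of a]]
    unfolding trace_U[OF that that] mult_2[symmetric] .
  have even_le: "h (2 * a) \<le> max (h (2 * 0)) (h (2 * r))" if "a \<le> r" for a
  proof (rule midpoint_convex_le_ends[where g = "\<lambda>a. h (2 * a)", OF _ that])
    fix a assume "0 < a" "a < r"
    then have "(a - 1) + (a + 1) = 2 * a" by simp
    then show "2 * h (2 * a) \<le> h (2 * (a - 1)) + h (2 * (a + 1))"
      using mid[of "a - 1" "a + 1"] \<open>a < r\<close> by (simp only:)
  qed
  \<comment> \<open>An odd \<open>i\<close> splits into unequal halves; one use of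
    \<open>mid\<close> then bounds \<open>h i\<close> by the values at the even arguments
    \<open>2 * a\<close> and \<open>2 * b\<close>.\<close>
  define a b where "a = i div 2" and "b = i - i div 2"
  have ab: "a \<le> r" "b \<le> r" "a + b = i" unfolding a_def b_def using \<open>i \<le> 2 * r\<close> by auto
  have "h i \<le> max (h (2 * 0)) (h (2 * r))"
    using mid[OF ab(1,2)] even_le[OF ab(1)] even_le[OF ab(2)] ab(3) by simp
  \<comment> \<open>Both ends are squared Frobenius norms, so their maximum is at most their
    sum.\<close>
  also have "\<dots> \<le> h 0 + h (2 * r)"
    using nonneg[of 0] nonneg[of r] by simp
  also have "h (2 * r) = trace_mat (D * D * X ^\<^sub>m (2 * r))"
  proof -
    have "h (2 * r) = trace_mat ((D * X ^\<^sub>m (2 * r)) * D)"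
      unfolding h_def using carrier_matD[OF Y(1)] by (simp add: right_mult_one_mat[of _ N N])
    also have "\<dots> = trace_mat (D * (D * X ^\<^sub>m (2 * r)))"
      by (rule trace_mat_comm[of _ N N]) simp_all
    finally show ?thesis by simp
  qed
  finally show ?thesis
    unfolding h_def using carrier_matD[OF X(1)] by (simp add: right_mult_one_mat[of _ N N])
qed

text \<open>The mean value inequality behind matrix Stein--type arguments: the difference of odd powers
  telescopes, and each term is controlled by interpolation.\<close>

lemma trace_odd_pow_diff:
  assumes D: "D \<in> carrier_mat N N" "transpose_mat D = D"
    and X: "X \<in> carrier_mat N N" "transpose_mat X = X"
    and Y: "Y \<in> carrier_mat N N" "transpose_mat Y = Y"
    and XY: "X - Y = c \<cdot>\<^sub>m D" and "0 \<le> c"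
  shows "trace_mat (D * X ^\<^sub>m (2 * r + 1)) - trace_mat (D * Y ^\<^sub>m (2 * r + 1))
    \<le> c * real (2 * r + 1) * (trace_mat (D * D * X ^\<^sub>m (2 * r)) + trace_mat (D * D * Y ^\<^sub>m (2 * r)))"
proof -
  define k where "k = 2 * r + 1"
  define T where "T i = trace_mat (D * X ^\<^sub>m i * Y ^\<^sub>m (k - i))" for i
  note [simp] = D X Y mult_square_carrier_mat assoc_mult_square_mat[of _ N]
  have step: "T (Suc i) - T i = c * trace_mat (D * X ^\<^sub>m i * D * Y ^\<^sub>m (2 * r - i))" if "i < k" for i
  proof -
    define j where "j = 2 * r - i"
    have j: "k - i = 1 + j" "k - Suc i = j" using that unfolding j_def k_def by auto
    have Yj: "Y ^\<^sub>m (1 + j) = Y * Y ^\<^sub>m j"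
      using pow_mat_add[OF Y(1), of 1 j] by simp
    have "T (Suc i) - T i
        = trace_mat (D * X ^\<^sub>m i * X * Y ^\<^sub>m j) - trace_mat (D * X ^\<^sub>m i * Y * Y ^\<^sub>m j)"
      unfolding T_def j Yj by simp
    also have "\<dots> = trace_mat (D * X ^\<^sub>m i * X * Y ^\<^sub>m j - D * X ^\<^sub>m i * Y * Y ^\<^sub>m j)"
      by (rule trace_mat_minus[of _ N, symmetric]) simp_all
    also have "D * X ^\<^sub>m i * X * Y ^\<^sub>m j - D * X ^\<^sub>m i * Y * Y ^\<^sub>m j = D * X ^\<^sub>m i * (X - Y) * Y ^\<^sub>m j"
      by (simp add: mult_minus_distrib_mat[of _ N N _ N] minus_mult_distrib_mat[of _ N N _ _ N])
    also have "\<dots> = c \<cdot>\<^sub>m (D * X ^\<^sub>m i * D * Y ^\<^sub>m j)"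
      unfolding XY by (simp add: mult_smult_distrib[of _ N N _ N] mult_smult_assoc_mat[of _ N N _ N])
    also have "trace_mat \<dots> = c * trace_mat (D * X ^\<^sub>m i * D * Y ^\<^sub>m j)"
      by (rule trace_mat_smult[of _ N]) simp
    finally show ?thesis unfolding j_def .
  qed
  have "trace_mat (D * X ^\<^sub>m k) - trace_mat (D * Y ^\<^sub>m k) = T k - T 0"
    unfolding T_def using carrier_matD[OF X(1)] carrier_matD[OF Y(1)] by simp
  also have "\<dots> = (\<Sum>i<k. T (Suc i) - T i)"
    by (rule sum_lessThan_telescope[symmetric])
  also have "\<dots> = (\<Sum>i<k. c * trace_mat (D * X ^\<^sub>m i * D * Y ^\<^sub>m (2 * r - i)))"
    by (intro sum.cong) (auto simp: step)
  also have "\<dots> \<le> (\<Sum>i<k. c * (trace_mat (D * D * X ^\<^sub>m (2 * r)) + trace_mat (D * D * Y ^\<^sub>m (2 * r))))"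
    using \<open>0 \<le> c\<close> trace_interpolation[OF D X Y, of _ r]
    by (intro sum_mono mult_left_mono) (auto simp: k_def add.commute)
  finally show ?thesis unfolding k_def by (simp add: algebra_simps)
qed

section \<open>Quadratic forms and the operator norm\<close>

lemma scalar_prod_self_nonneg: "0 \<le> v \<bullet> (v :: real vec)"
  unfolding scalar_prod_def by (intro sum_nonneg) simp

lemma scalar_prod_Cauchy_Schwarz:
  assumes "u \<in> carrier_vec n" "v \<in> carrier_vec n"
  shows "(u \<bullet> v)\<^sup>2 \<le> (u \<bullet> u) * (v \<bullet> (v :: real vec))"
  using Cauchy_Schwarz_ineq_sum[of "\<lambda>i. u $ i" "\<lambda>i. v $ i" "{0..<n}"] assms
  by (simp add: scalar_prod_def power2_eq_square)

text \<open>Expand the square of \<open>v - c u\<close>. The free weight \<open>c\<close> allows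
  norms to be compared at a prescribed growth rate.\<close>

lemma scalar_prod_am_gm:
  assumes u: "u \<in> carrier_vec n" and v: "v \<in> carrier_vec n"
  shows "2 * c * (u \<bullet> v) \<le> c\<^sup>2 * (u \<bullet> u) + v \<bullet> (v :: real vec)"
proof -
  have "(v - c \<cdot>\<^sub>v u) \<bullet> (v - c \<cdot>\<^sub>v u)
      = v \<bullet> v - c * (v \<bullet> u) - (c * (u \<bullet> v) - c * (c * (u \<bullet> u)))"
    using u v by (simp add: minus_scalar_prod_distrib[of _ n] scalar_prod_minus_distrib[of _ n] algebra_simps)
  with scalar_prod_self_nonneg[of "v - c \<cdot>\<^sub>v u"] show ?thesis
    by (simp add: comm_scalar_prod[OF v u] power2_eq_square)
qed

lemma symmetric_mat_scalar_prod:
  fixes X :: "real mat"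
  assumes "X \<in> carrier_mat N N" "transpose_mat X = X" "u \<in> carrier_vec N" "v \<in> carrier_vec N"
  shows "(X *\<^sub>v u) \<bullet> v = u \<bullet> (X *\<^sub>v v)"
  using transpose_vec_mult_scalar[OF assms(1,4,3)] assms(2) by simp

text \<open>Cauchy--Schwarz row by row: the operator norm is at most the Frobenius norm.\<close>

lemma sum_mult_mat_vec_le_trace:
  fixes V :: "real mat"
  assumes V: "V \<in> carrier_mat K N" and v: "v \<in> carrier_vec N"
  shows "(V *\<^sub>v v) \<bullet> (V *\<^sub>v v) \<le> trace_mat (transpose_mat V * V) * (v \<bullet> v)"
proof -
  have "(V *\<^sub>v v) \<bullet> (V *\<^sub>v v) = (\<Sum>k<K. (row V k \<bullet> v)\<^sup>2)"
    using V by (simp add: scalar_prod_def[of "V *\<^sub>v v"] power2_eq_square atLeast0LessThan)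
  also have "\<dots> \<le> (\<Sum>k<K. (row V k \<bullet> row V k) * (v \<bullet> v))"
    using V v by (intro sum_mono scalar_prod_Cauchy_Schwarz[of _ N]) auto
  also have "\<dots> = (\<Sum>k<K. \<Sum>i<N. V $$ (k, i) * V $$ (k, i)) * (v \<bullet> v)"
    using V by (simp add: scalar_prod_def[of "row _ _"] sum_distrib_right atLeast0LessThan)
  also have "(\<Sum>k<K. \<Sum>i<N. V $$ (k, i) * V $$ (k, i)) = trace_mat (transpose_mat V * V)"
    unfolding trace_transpose_mult[OF V V] by (rule sum.swap)
  finally show ?thesis .
qed

text \<open>The sequence \<open>\<parallel>X\<^sup>k v\<parallel>\<^sup>2\<close> is log-convex in \<open>k\<close>, so a growth factor above \<open>\<eta>\<^sup>2\<close> in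
  its first step persists.\<close>

lemma quadratic_form_le_of_trace_pow:
  fixes X :: "real mat"
  assumes X: "X \<in> carrier_mat N N" "transpose_mat X = X"
    and tr: "trace_mat (X ^\<^sub>m (2 * p)) \<le> \<eta> ^ (2 * p)" and "0 < p" and "0 < \<eta>"
    and v: "v \<in> carrier_vec N"
  shows "\<bar>v \<bullet> (X *\<^sub>v v)\<bar> \<le> \<eta> * (v \<bullet> v)"
proof -
  define u where "u k = (X ^\<^sub>m k) *\<^sub>v v" for k
  define q where "q k = u k \<bullet> u k" for k
  define c where "c = \<eta>\<^sup>2"
  have "0 < c" using \<open>0 < \<eta>\<close> by (simp add: c_def)
  have u: "u k \<in> carrier_vec N" for k
    unfolding u_def using X v by (simp add: mult_mat_vec_carrier[of _ N N])
  have u0: "u 0 = v" unfolding u_def using X v by simp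
  have Suc_u: "u (Suc k) = X *\<^sub>v u k" for k
  proof -
    have "X ^\<^sub>m Suc k = X * X ^\<^sub>m k" using pow_mat_add[OF X(1), of 1 k] X by simp
    then show ?thesis unfolding u_def using X v by (simp add: assoc_mult_mat_vec[of _ N N _ N])
  qed
  have u1: "u 1 = X *\<^sub>v v" using Suc_u[of 0] u0 by simp
  \<comment> \<open>By symmetry of \<open>X\<close>, the inner product of \<open>u k\<close> and
    \<open>u (Suc (Suc k))\<close> is \<open>q (Suc k)\<close>.\<close>
  have q_convex: "2 * c * q (Suc k) \<le> c\<^sup>2 * q k + q (Suc (Suc k))" for k
    using scalar_prod_am_gm[OF u[of k] u[of "Suc (Suc k)"], of c]
      symmetric_mat_scalar_prod[OF X u[of k] u[of "Suc k"]]
    unfolding q_def Suc_u by simp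
  have "q 1 \<le> c * q 0"
  proof (rule ccontr)
    assume "\<not> q 1 \<le> c * q 0"
    have growth: "q (Suc k) > c * q k" for k
    proof (induction k)
      case (Suc k)
      then have "c * (c * q k) < c * q (Suc k)" using \<open>0 < c\<close> by simp
      with q_convex[of k] show ?case by (simp add: power2_eq_square)
    qed (use \<open>\<not> q 1 \<le> c * q 0\<close> in simp)
    \<comment> \<open>Stated for \<open>Suc k\<close> because the strict inequality fails at
      exponent 0; this is where \<open>0 < p\<close> enters.\<close>
    have "q (Suc k) > c ^ Suc k * q 0" for k
    proof (induction k)
      case (Suc k)
      then have "c * (c ^ Suc k * q 0) < c * q (Suc k)" using \<open>0 < c\<close> by simp
      with growth[of "Suc k"] show ?case by (simp add: mult.assoc)
    qed (use growth[of 0] in simp)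
    from this[of "p - 1"] have "q p > c ^ p * q 0" using \<open>0 < p\<close> by simp
    \<comment> \<open>The opposing bound: the trace of \<open>X^(2p)\<close> is the squared
      Frobenius norm of \<open>X^p\<close>.\<close>
    moreover have "q p \<le> trace_mat (X ^\<^sub>m (2 * p)) * q 0"
      using sum_mult_mat_vec_le_trace[of "X ^\<^sub>m p" N N v] X v
      unfolding q_def u0 by (simp add: u_def transpose_pow_mat[of _ N] pow_mat_add[of X N p p, symmetric] mult_2)
    moreover have "trace_mat (X ^\<^sub>m (2 * p)) * q 0 \<le> c ^ p * q 0"
      using tr scalar_prod_self_nonneg[of v] unfolding q_def u0 c_def
      by (intro mult_right_mono) (auto simp: power_mult)
    ultimately show False by simp
  qed
  have "(v \<bullet> (X *\<^sub>v v))\<^sup>2 \<le> (v \<bullet> v) * q 1"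
    using scalar_prod_Cauchy_Schwarz[OF v u[of 1]] unfolding q_def u1 .
  also have "\<dots> \<le> (v \<bullet> v) * (c * (v \<bullet> v))"
    using \<open>q 1 \<le> c * q 0\<close> scalar_prod_self_nonneg[of v] unfolding q_def u0
    by (intro mult_left_mono) auto
  also have "\<dots> = (\<eta> * (v \<bullet> v))\<^sup>2" by (simp add: c_def power2_eq_square)
  finally show ?thesis
    using \<open>0 < \<eta>\<close> scalar_prod_self_nonneg[of v] by (simp add: power2_le_iff_abs_le)
qed

section \<open>Moments of empirical means of rank-one matrices\<close>

lemma trace_mat_minus_mult:
  assumes "A \<in> carrier_mat N N" "B \<in> carrier_mat N N" "W \<in> carrier_mat N N"
  shows "trace_mat ((A - B) * W) = trace_mat (A * W) - trace_mat (B * W)"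
  using assms
  by (simp add: minus_mult_distrib_mat[of _ N N _ _ N] trace_mat_minus[of _ N] mult_square_carrier_mat)

text \<open>Cyclicity turns the trace into the squared Frobenius norm of
  \<open>E X^r\<close>.\<close>

lemma trace_mult_square_nonneg:
  assumes E: "E \<in> carrier_mat N N" "transpose_mat E = E"
    and X: "X \<in> carrier_mat N N" "transpose_mat X = X"
  shows "0 \<le> trace_mat (E * E * X ^\<^sub>m (2 * r))"
proof -
  note [simp] = E X mult_square_carrier_mat assoc_mult_square_mat[of _ N]
    transpose_mult[of _ N N _ N] transpose_pow_mat[of _ N]
  have "E * E * X ^\<^sub>m (2 * r) = (E * E * X ^\<^sub>m r) * X ^\<^sub>m r"
    by (simp add: mult_2 pow_mat_add[of X N r r])
  then have "trace_mat (E * E * X ^\<^sub>m (2 * r)) = trace_mat (X ^\<^sub>m r * (E * E * X ^\<^sub>m r))"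
    using trace_mat_comm[of "E * E * X ^\<^sub>m r" N N "X ^\<^sub>m r"] by simp
  also have "X ^\<^sub>m r * (E * E * X ^\<^sub>m r) = transpose_mat (E * X ^\<^sub>m r) * (E * X ^\<^sub>m r)"
    by simp
  finally show ?thesis
    using trace_transpose_mult_self_nonneg[of "E * X ^\<^sub>m r" N N] by simp
qed

lemma quadratic_even_pow_nonneg:
  fixes X :: "real mat"
  assumes X: "X \<in> carrier_mat N N" "transpose_mat X = X" and v: "v \<in> carrier_vec N"
  shows "0 \<le> v \<bullet> (X ^\<^sub>m (2 * r) *\<^sub>v v)"
proof -
  have "X ^\<^sub>m (2 * r) *\<^sub>v v = X ^\<^sub>m r *\<^sub>v (X ^\<^sub>m r *\<^sub>v v)"
    using X v by (simp add: mult_2 pow_mat_add[of X N r r] assoc_mult_mat_vec[of _ N N _ N])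
  then have "v \<bullet> (X ^\<^sub>m (2 * r) *\<^sub>v v) = (X ^\<^sub>m r *\<^sub>v v) \<bullet> (X ^\<^sub>m r *\<^sub>v v)"
    using symmetric_mat_scalar_prod[of "X ^\<^sub>m r" N v "X ^\<^sub>m r *\<^sub>v v"] X v
    by (simp add: transpose_pow_mat[of _ N] mult_mat_vec_carrier[of _ N N])
  then show ?thesis by (simp add: scalar_prod_self_nonneg)
qed

section \<open>Rank-one matrices and the sampling model\<close>

definition outer_square :: "real vec \<Rightarrow> real mat" where
  "outer_square z = mat (dim_vec z) (dim_vec z) (\<lambda>(a, b). z $ a * z $ b)"

lemma outer_square_carrier[simp]:
  "z \<in> carrier_vec N \<Longrightarrow> outer_square z \<in> carrier_mat N N"
  by (auto simp: outer_square_def)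

lemma transpose_outer_square[simp]: "transpose_mat (outer_square z) = outer_square z"
  by (rule eq_matI) (auto simp: outer_square_def)

lemma quadratic_form_eq_sum:
  assumes "W \<in> carrier_mat N N" "z \<in> carrier_vec N"
  shows "z \<bullet> (W *\<^sub>v z) = (\<Sum>a<N. \<Sum>b<N. z $ a * z $ b * (W $$ (b, a) :: real))"
proof -
  have "z \<bullet> (W *\<^sub>v z) = (\<Sum>b<N. \<Sum>a<N. z $ a * z $ b * W $$ (b, a))"
    using assms by (auto simp: scalar_prod_def sum_distrib_left atLeast0LessThan intro!: sum.cong)
  then show ?thesis by (subst sum.swap)
qed

lemma trace_outer_square_mult:
  assumes "W \<in> carrier_mat N N" "z \<in> carrier_vec N"
  shows "trace_mat (outer_square z * W) = z \<bullet> (W *\<^sub>v z)"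
  unfolding quadratic_form_eq_sum[OF assms]
  using assms by (subst trace_mat_mult[of _ N N]) (auto simp: outer_square_def intro!: sum.cong)

lemma outer_square_mult_self:
  assumes "z \<in> carrier_vec N"
  shows "outer_square z * outer_square z = (z \<bullet> z) \<cdot>\<^sub>m outer_square z"
  using assms
  by (intro eq_matI)
    (auto simp: outer_square_def scalar_prod_def sum_distrib_right intro!: sum.cong)

text \<open>In the application \<open>z\<^sub>j = B H\<inverse> a\<^sub>j\<close>, and the last assumption says \<open>\<Sigma> \<le> I\<close>.\<close>

locale rank_one_sampling =
  fixes N n s :: nat and z :: "nat \<Rightarrow> real vec" and M :: real
  assumes n_pos: "0 < n" and s_pos: "0 < s"
    and z_carrier: "z j \<in> carrier_vec N"
    and z_bound: "j < n \<Longrightarrow> z j \<bullet> z j \<le> M"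
    and mean_le: "v \<in> carrier_vec N \<Longrightarrow> (\<Sum>j<n. (z j \<bullet> v)\<^sup>2) \<le> real n * (v \<bullet> v)"
begin

text \<open>The support of \<open>uniform_sampling n s\<close>, with the same default value 0.
  Expectations become finite sums over it, up to the factor \<open>card samples\<close>.\<close>

definition samples :: "(nat \<Rightarrow> nat) set" where
  "samples = PiE_dflt {..<s} 0 (\<lambda>_. {..<n})"

text \<open>The population mean \<Sigma> of the overview.\<close>

definition mean_mat :: "real mat" where
  "mean_mat = mat N N (\<lambda>(a, b). (\<Sum>j<n. z j $ a * z j $ b) / real n)"

text \<open>The matrix \<open>X\<close> of the overview: empirical mean minus population
  mean.\<close>

definition dev :: "(nat \<Rightarrow> nat) \<Rightarrow> real mat" where
  "dev \<sigma> = mat N N (\<lambda>(a, b). (\<Sum>k<s. z (\<sigma> k) $ a * z (\<sigma> k) $ b) / real s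
      - (\<Sum>j<n. z j $ a * z j $ b) / real n)"

text \<open>The trace of \<Sigma>, see \<open>trace_mean_mat\<close>. It takes the place of the
  dimension \<open>N\<close> in the tail bound and becomes the effective dimension in the
  application.\<close>

definition mean_trace :: real where
  "mean_trace = (\<Sum>j<n. z j \<bullet> z j) / real n"

lemma dev_carrier[simp]: "dev \<sigma> \<in> carrier_mat N N"
  and mean_mat_carrier[simp]: "mean_mat \<in> carrier_mat N N"
  by (auto simp: dev_def mean_mat_def)

lemma transpose_dev[simp]: "transpose_mat (dev \<sigma>) = dev \<sigma>"
  by (rule eq_matI) (auto simp: dev_def mult.commute)

lemma trace_mean_mat_mult:
  assumes "W \<in> carrier_mat N N"
  shows "trace_mat (mean_mat * W) = (\<Sum>j<n. z j \<bullet> (W *\<^sub>v z j)) / real n"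
proof -
  have "trace_mat (mean_mat * W)
      = (\<Sum>a<N. \<Sum>b<N. \<Sum>j<n. z j $ a * z j $ b * W $$ (b, a) / real n)"
    using assms
    by (subst trace_mat_mult[of _ N N])
      (auto simp: mean_mat_def sum_divide_distrib sum_distrib_right intro!: sum.cong)
  also have "\<dots> = (\<Sum>j<n. \<Sum>a<N. \<Sum>b<N. z j $ a * z j $ b * W $$ (b, a) / real n)"
    by (subst sum.swap[of _ "{..<n}"], subst (2) sum.swap) (rule refl)
  finally show ?thesis
    by (simp add: quadratic_form_eq_sum[OF assms z_carrier] sum_divide_distrib)
qed

lemma trace_dev_mult:
  assumes "W \<in> carrier_mat N N"
  shows "trace_mat (dev \<sigma> * W)
    = (\<Sum>k<s. z (\<sigma> k) \<bullet> (W *\<^sub>v z (\<sigma> k))) / real s - (\<Sum>j<n. z j \<bullet> (W *\<^sub>v z j)) / real n"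
proof -
  have "trace_mat (dev \<sigma> * W)
      = (\<Sum>a<N. \<Sum>b<N. (\<Sum>k<s. z (\<sigma> k) $ a * z (\<sigma> k) $ b * W $$ (b, a) / real s)
          - (\<Sum>j<n. z j $ a * z j $ b * W $$ (b, a) / real n))"
    using assms
    by (subst trace_mat_mult[of _ N N])
      (auto simp: dev_def sum_divide_distrib sum_distrib_right left_diff_distrib intro!: sum.cong)
  also have "\<dots> = (\<Sum>k<s. \<Sum>a<N. \<Sum>b<N. z (\<sigma> k) $ a * z (\<sigma> k) $ b * W $$ (b, a) / real s)
      - (\<Sum>j<n. \<Sum>a<N. \<Sum>b<N. z j $ a * z j $ b * W $$ (b, a) / real n)"
    unfolding sum_subtractf
    by (subst (2 5) sum.swap, subst (1 4) sum.swap) (rule refl)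
  finally show ?thesis
    by (simp add: quadratic_form_eq_sum[OF assms z_carrier] sum_divide_distrib)
qed

section \<open>Exchangeable pairs from redrawing one sample\<close>

lemma finite_samples[simp]: "finite samples"
  unfolding samples_def by (intro finite_PiE_dflt) auto

lemma samples_less: "\<sigma> \<in> samples \<Longrightarrow> k < s \<Longrightarrow> \<sigma> k < n"
  unfolding samples_def PiE_dflt_def by auto

lemma resample_in_samples: "\<sigma> \<in> samples \<Longrightarrow> k < s \<Longrightarrow> j < n \<Longrightarrow> \<sigma>(k := j) \<in> samples"
  unfolding samples_def PiE_dflt_def by auto

text \<open>Exchangeability: mapping \<open>(\<sigma>, j)\<close> to
  \<open>(\<sigma>(k := j), \<sigma> k)\<close> is an involution that swaps the old and the new
  sample.\<close>

lemma sum_resample_swap: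
  assumes "k < s"
  shows "(\<Sum>\<sigma>\<in>samples. \<Sum>j<n. \<Phi> \<sigma> (\<sigma>(k := j)))
    = (\<Sum>\<sigma>\<in>samples. \<Sum>j<n. \<Phi> (\<sigma>(k := j)) \<sigma> :: real)"
  unfolding sum.cartesian_product
  by (rule sum.reindex_bij_witness[where i = "\<lambda>(\<sigma>, j). (\<sigma>(k := j), \<sigma> k)"
        and j = "\<lambda>(\<sigma>, j). (\<sigma>(k := j), \<sigma> k)"])
    (use assms in \<open>auto simp: samples_less resample_in_samples\<close>)

text \<open>Only the \<open>k\<close>-th summand of the empirical mean changes, and the population
  mean cancels.\<close>

lemma dev_resample_diff:
  assumes "k < s"
  shows "dev \<sigma> - dev (\<sigma>(k := j)) = (1 / real s) \<cdot>\<^sub>m (outer_square (z (\<sigma> k)) - outer_square (z j))"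
proof (rule eq_matI)
  fix a b
  assume "a < dim_row ((1 / real s) \<cdot>\<^sub>m (outer_square (z (\<sigma> k)) - outer_square (z j)))"
    and "b < dim_col ((1 / real s) \<cdot>\<^sub>m (outer_square (z (\<sigma> k)) - outer_square (z j)))"
  then have ab: "a < N" "b < N" by (auto simp: outer_square_def carrier_vecD[OF z_carrier])
  have *: "(\<Sum>i<s. f (\<sigma> i)) - (\<Sum>i<s. f ((\<sigma>(k := j)) i)) = f (\<sigma> k) - f j" for f :: "nat \<Rightarrow> real"
  proof -
    have "(\<Sum>i<s. f (\<sigma> i)) - (\<Sum>i<s. f ((\<sigma>(k := j)) i)) = (\<Sum>i<s. if i = k then f (\<sigma> k) - f j else 0)"
      unfolding sum_subtractf[symmetric] by (intro sum.cong) auto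
    with assms show ?thesis by simp
  qed
  show "(dev \<sigma> - dev (\<sigma>(k := j))) $$ (a, b)
      = ((1 / real s) \<cdot>\<^sub>m (outer_square (z (\<sigma> k)) - outer_square (z j))) $$ (a, b)"
    using ab z_carrier[of j] z_carrier[of "\<sigma> k"] *[of "\<lambda>i. z i $ a * z i $ b"]
    by (simp add: dev_def outer_square_def carrier_vecD[OF z_carrier] diff_divide_distrib[symmetric])
qed (simp_all add: dev_def outer_square_def carrier_vecD[OF z_carrier])

text \<open>This is \<open>s\<close> times the change of \<open>dev\<close> when a draw
  \<open>j\<close> is replaced by \<open>i\<close>.\<close>

definition diff_mat :: "nat \<Rightarrow> nat \<Rightarrow> real mat" where
  "diff_mat i j = outer_square (z i) - outer_square (z j)"

lemma diff_mat_carrier[simp]: "diff_mat i j \<in> carrier_mat N N"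
  unfolding diff_mat_def by (intro minus_carrier_mat outer_square_carrier z_carrier)

lemma transpose_diff_mat[simp]: "transpose_mat (diff_mat i j) = diff_mat i j"
  unfolding diff_mat_def using transpose_minus[OF outer_square_carrier[OF z_carrier] outer_square_carrier[OF z_carrier]]
  by simp

lemma diff_mat_commute: "diff_mat j i = (-1) \<cdot>\<^sub>m diff_mat i j"
  using z_carrier[of i] z_carrier[of j]
  by (intro eq_matI) (auto simp: diff_mat_def outer_square_def)

lemma trace_diff_mat_mult:
  assumes "W \<in> carrier_mat N N"
  shows "trace_mat (diff_mat i j * W) = z i \<bullet> (W *\<^sub>v z i) - z j \<bullet> (W *\<^sub>v z j)"
  unfolding diff_mat_def using assms z_carrier
  by (simp add: trace_mat_minus_mult[of _ N] trace_outer_square_mult[of _ N])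

text \<open>With \<open>P\<close>, \<open>Q\<close> the two rank-one matrices,
  \<open>(P - Q)^2 + (P + Q)^2 = 2 P^2 + 2 Q^2\<close>, and the second square has nonnegative trace
  against an even power. Moreover \<open>P^2\<close> is \<open>P\<close> scaled by the squared norm
  of its vector, which is at most \<open>M\<close>.\<close>

lemma trace_diff_mat_square_le:
  fixes r :: nat
  assumes X: "X \<in> carrier_mat N N" "transpose_mat X = X" and "i < n" "j < n"
  defines "W \<equiv> X ^\<^sub>m (2 * r)"
  shows "trace_mat (diff_mat i j * diff_mat i j * W)
    \<le> 2 * M * (z i \<bullet> (W *\<^sub>v z i) + z j \<bullet> (W *\<^sub>v z j))"
proof -
  define P Q where "P = outer_square (z i)" and "Q = outer_square (z j)"
  have PQ[simp]: "P \<in> carrier_mat N N" "Q \<in> carrier_mat N N"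
      "transpose_mat P = P" "transpose_mat Q = Q"
    unfolding P_def Q_def using z_carrier by auto
  have W[simp]: "W \<in> carrier_mat N N" unfolding W_def using X by simp
  have expand: "(P - Q) * (P - Q) + (P + Q) * (P + Q) = 2 \<cdot>\<^sub>m (P * P) + 2 \<cdot>\<^sub>m (Q * Q)"
  proof -
    have "(P - Q) * (P - Q) = P * P - Q * P - (P * Q - Q * Q)"
      by (simp add: mult_minus_distrib_mat[of _ N N _ N] minus_mult_distrib_mat[of _ N N _ _ N]
          minus_carrier_mat)
    moreover have "(P + Q) * (P + Q) = P * P + Q * P + (P * Q + Q * Q)"
      by (simp add: mult_add_distrib_mat[of _ N N _ N] add_mult_distrib_mat[of _ N N _ _ N])
    moreover have comb: "A - B - (C - D) + (A + B + (C + D)) = 2 \<cdot>\<^sub>m A + 2 \<cdot>\<^sub>m D"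
      if "A \<in> carrier_mat N N" "B \<in> carrier_mat N N" "C \<in> carrier_mat N N" "D \<in> carrier_mat N N"
      for A B C D :: "real mat"
      using that by (intro eq_matI) auto
    ultimately show ?thesis
      by (simp only: comb[of "P * P" "Q * P" "P * Q" "Q * Q"] mult_square_carrier_mat PQ)
  qed
  have trace_add: "trace_mat (U * W) + trace_mat (V * W) = trace_mat ((U + V) * W)"
    if "U \<in> carrier_mat N N" "V \<in> carrier_mat N N" for U V
    using that
    by (simp add: add_mult_distrib_mat[of _ N N _ _ N] trace_mat_add[of _ N] mult_square_carrier_mat)
  have trace_2: "trace_mat (2 \<cdot>\<^sub>m U * W) = 2 * trace_mat (U * W)" if "U \<in> carrier_mat N N" for U
    using that
    by (simp add: mult_smult_assoc_mat[of _ N N _ N] trace_mat_smult[of _ N] mult_square_carrier_mat)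
  have "trace_mat ((P - Q) * (P - Q) * W) + trace_mat ((P + Q) * (P + Q) * W)
      = trace_mat ((2 \<cdot>\<^sub>m (P * P) + 2 \<cdot>\<^sub>m (Q * Q)) * W)"
    unfolding expand[symmetric]
    by (intro trace_add mult_square_carrier_mat minus_carrier_mat add_carrier_mat PQ)
  also have "\<dots> = trace_mat (2 \<cdot>\<^sub>m (P * P) * W) + trace_mat (2 \<cdot>\<^sub>m (Q * Q) * W)"
    by (intro trace_add[symmetric] smult_carrier_mat mult_square_carrier_mat PQ)
  also have "\<dots> = 2 * trace_mat (P * P * W) + 2 * trace_mat (Q * Q * W)"
    by (simp only: trace_2 mult_square_carrier_mat PQ)
  also have "trace_mat (P * P * W) = (z i \<bullet> z i) * (z i \<bullet> (W *\<^sub>v z i))"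
    unfolding P_def outer_square_mult_self[OF z_carrier] using z_carrier
    by (simp add: mult_smult_assoc_mat[of _ N N _ N] trace_mat_smult[of _ N] mult_square_carrier_mat
        trace_outer_square_mult[of _ N])
  also have "trace_mat (Q * Q * W) = (z j \<bullet> z j) * (z j \<bullet> (W *\<^sub>v z j))"
    unfolding Q_def outer_square_mult_self[OF z_carrier] using z_carrier
    by (simp add: mult_smult_assoc_mat[of _ N N _ N] trace_mat_smult[of _ N] mult_square_carrier_mat
        trace_outer_square_mult[of _ N])
  finally have "trace_mat ((P - Q) * (P - Q) * W) + trace_mat ((P + Q) * (P + Q) * W)
      = 2 * ((z i \<bullet> z i) * (z i \<bullet> (W *\<^sub>v z i))) + 2 * ((z j \<bullet> z j) * (z j \<bullet> (W *\<^sub>v z j)))" .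
  moreover have "0 \<le> trace_mat ((P + Q) * (P + Q) * W)"
    unfolding W_def using transpose_add[OF PQ(1,2)] by (intro trace_mult_square_nonneg[of _ N] X) auto
  moreover have scaled: "(z k \<bullet> z k) * (z k \<bullet> (W *\<^sub>v z k)) \<le> M * (z k \<bullet> (W *\<^sub>v z k))" if "k < n" for k
    unfolding W_def using that z_bound quadratic_even_pow_nonneg[OF X z_carrier]
    by (intro mult_right_mono) auto
  ultimately have "trace_mat ((P - Q) * (P - Q) * W)
      \<le> 2 * (M * (z i \<bullet> (W *\<^sub>v z i))) + 2 * (M * (z j \<bullet> (W *\<^sub>v z j)))"
    using scaled[OF \<open>i < n\<close>] scaled[OF \<open>j < n\<close>] by linarith
  then show ?thesis
    unfolding diff_mat_def P_def Q_def by (simp only: distrib_left mult.assoc)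
qed

text \<open>For each \<sigma>, the matrices \<open>diff_mat (\<sigma> k) j\<close> sum to
  \<open>n s\<close> times \<open>dev \<sigma>\<close>. So the deviation is proportional to its own
  average change under redrawing, which starts the exchangeable pair argument.\<close>

lemma sum_dev_mult_exchange:
  assumes "\<And>\<sigma>. W \<sigma> \<in> carrier_mat N N"
  shows "real (n * s) * (\<Sum>\<sigma>\<in>samples. trace_mat (dev \<sigma> * W \<sigma>))
    = (\<Sum>k<s. \<Sum>\<sigma>\<in>samples. \<Sum>j<n. trace_mat (diff_mat (\<sigma> k) j * W \<sigma>))"
proof -
  have "real (n * s) * trace_mat (dev \<sigma> * W \<sigma>)
      = (\<Sum>k<s. \<Sum>j<n. trace_mat (diff_mat (\<sigma> k) j * W \<sigma>))" for \<sigma>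
    using n_pos s_pos
    by (simp add: trace_dev_mult[OF assms] trace_diff_mat_mult[OF assms] sum_subtractf
        sum_distrib_left[symmetric] field_simps)
  then show ?thesis
    by (simp add: sum_distrib_left) (rule sum.swap)
qed

lemma diff_mat_square_commute: "diff_mat j i * diff_mat j i = diff_mat i j * diff_mat i j"
proof -
  have "diff_mat j i * diff_mat j i = (-1) \<cdot>\<^sub>m ((-1) \<cdot>\<^sub>m (diff_mat i j * diff_mat i j))"
    unfolding diff_mat_commute[of j i]
    by (simp add: mult_smult_assoc_mat[of _ N N _ N] mult_smult_distrib[of _ N N _ N])
  then show ?thesis by (auto intro!: eq_matI)
qed

text \<open>Swapping the old and the new draw flips the sign of \<open>diff_mat\<close>, so the sum
  equals its own negative.\<close>

lemma sum_trace_dev: "(\<Sum>\<sigma>\<in>samples. trace_mat (dev \<sigma>)) = 0"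
proof -
  have "(\<Sum>\<sigma>\<in>samples. \<Sum>j<n. trace_mat (diff_mat (\<sigma> k) j)) = 0" if "k < s" for k
  proof -
    have anti: "trace_mat (diff_mat j i) = - trace_mat (diff_mat i j)" for i j
      unfolding diff_mat_commute[of j i] by (simp add: trace_mat_smult[of _ N])
    have "(\<Sum>\<sigma>\<in>samples. \<Sum>j<n. trace_mat (diff_mat (\<sigma> k) j))
        = (\<Sum>\<sigma>\<in>samples. \<Sum>j<n. trace_mat (diff_mat j (\<sigma> k)))"
      using sum_resample_swap[OF that, of "\<lambda>\<sigma> \<tau>. trace_mat (diff_mat (\<sigma> k) (\<tau> k))"] by simp
    also have "\<dots> = (\<Sum>\<sigma>\<in>samples. \<Sum>j<n. - trace_mat (diff_mat (\<sigma> k) j))"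
      by (intro sum.cong refl anti)
    finally show ?thesis by (simp add: sum_negf)
  qed
  then have "real (n * s) * (\<Sum>\<sigma>\<in>samples. trace_mat (dev \<sigma> * 1\<^sub>m N)) = 0"
    by (subst sum_dev_mult_exchange) (simp_all add: right_mult_one_mat[of _ N N] sum.neutral)
  then show ?thesis using n_pos s_pos by (simp add: right_mult_one_mat[of _ N N])
qed

text \<open>This is the recursion of the overview with \<open>q = r + 1\<close>. One factor of
  \<open>dev\<close> is replaced by its average change under redrawing. Symmetrising over the swap
  leaves the remaining odd power only as a difference of two copies, to which
  \<open>trace_odd_pow_diff\<close> applies with factor \<open>1 / s\<close>.\<close>

lemma sum_even_moment_le:
  "(\<Sum>\<sigma>\<in>samples. trace_mat (dev \<sigma> ^\<^sub>m (2 * r + 2)))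
    \<le> 2 * M * real (2 * r + 1) / real s *
      (\<Sum>\<sigma>\<in>samples. trace_mat (dev \<sigma> ^\<^sub>m (2 * r + 1)) + 2 * trace_mat (mean_mat * dev \<sigma> ^\<^sub>m (2 * r)))"
proof -
  define W where "W \<sigma> = dev \<sigma> ^\<^sub>m (2 * r)" for \<sigma>
  define q where "q \<sigma> i = z i \<bullet> (W \<sigma> *\<^sub>v z i)" for \<sigma> i
  define c where "c = real (2 * r + 1) / real s"
  have W[simp]: "W \<sigma> \<in> carrier_mat N N" for \<sigma> unfolding W_def by simp
  have "0 \<le> c" unfolding c_def by simp
  have dev_pow: "dev \<sigma> * dev \<sigma> ^\<^sub>m i = dev \<sigma> ^\<^sub>m (Suc i)" for \<sigma> i
    using pow_mat_add[OF dev_carrier, of \<sigma> 1 i] by simp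
  have step: "(\<Sum>\<sigma>\<in>samples. \<Sum>j<n. trace_mat (diff_mat (\<sigma> k) j * dev \<sigma> ^\<^sub>m (2 * r + 1)))
      \<le> c * (\<Sum>\<sigma>\<in>samples. \<Sum>j<n. 2 * M * (q \<sigma> (\<sigma> k) + q \<sigma> j))" if "k < s" for k
  proof -
    \<comment> \<open>Keeping both samples as arguments makes the swap visible: since
      \<open>diff_mat\<close> is antisymmetric,
      \<open>\<Phi> \<sigma> \<tau> + \<Phi> \<tau> \<sigma>\<close> is the trace of
      \<open>diff_mat\<close> times a difference of odd powers.\<close>
    define \<Phi> where "\<Phi> \<sigma> \<tau> = trace_mat (diff_mat (\<sigma> k) (\<tau> k) * dev \<sigma> ^\<^sub>m (2 * r + 1))" for \<sigma> \<tau>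
    define \<Psi> where "\<Psi> \<sigma> \<tau> = trace_mat (diff_mat (\<sigma> k) (\<tau> k) * diff_mat (\<sigma> k) (\<tau> k) * W \<sigma>)" for \<sigma> \<tau>
    have "\<Phi> \<sigma> (\<sigma>(k := j)) + \<Phi> (\<sigma>(k := j)) \<sigma> \<le> c * (\<Psi> \<sigma> (\<sigma>(k := j)) + \<Psi> (\<sigma>(k := j)) \<sigma>)"
      for \<sigma> j
    proof -
      define \<tau> where "\<tau> = \<sigma>(k := j)"
      have \<tau>k: "\<tau> k = j" unfolding \<tau>_def by simp
      have "\<Phi> \<tau> \<sigma> = - trace_mat (diff_mat (\<sigma> k) j * dev \<tau> ^\<^sub>m (2 * r + 1))"
        unfolding \<Phi>_def \<tau>k diff_mat_commute[of j]
        by (simp add: mult_smult_assoc_mat[of _ N N _ N] trace_mat_smult[of _ N] mult_square_carrier_mat)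
      moreover have "\<Psi> \<tau> \<sigma> = trace_mat (diff_mat (\<sigma> k) j * diff_mat (\<sigma> k) j * W \<tau>)"
        unfolding \<Psi>_def \<tau>k diff_mat_square_commute[of j] ..
      moreover have "\<Phi> \<sigma> \<tau> - trace_mat (diff_mat (\<sigma> k) j * dev \<tau> ^\<^sub>m (2 * r + 1))
          \<le> 1 / real s * real (2 * r + 1) *
            (\<Psi> \<sigma> \<tau> + trace_mat (diff_mat (\<sigma> k) j * diff_mat (\<sigma> k) j * W \<tau>))"
        unfolding \<Phi>_def \<Psi>_def \<tau>k W_def
        using dev_resample_diff[OF that, of \<sigma> j]
        by (intro trace_odd_pow_diff[of _ N]) (auto simp: \<tau>_def diff_mat_def[symmetric])
      ultimately show ?thesis unfolding \<tau>_def[symmetric] c_def by simp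
    qed
    then have "(\<Sum>\<sigma>\<in>samples. \<Sum>j<n. \<Phi> \<sigma> (\<sigma>(k := j)) + \<Phi> (\<sigma>(k := j)) \<sigma>)
        \<le> (\<Sum>\<sigma>\<in>samples. \<Sum>j<n. c * (\<Psi> \<sigma> (\<sigma>(k := j)) + \<Psi> (\<sigma>(k := j)) \<sigma>))"
      by (intro sum_mono)
    \<comment> \<open>By exchangeability both halves of each symmetrised sum agree, and the factor 2
      cancels.\<close>
    then have "(\<Sum>\<sigma>\<in>samples. \<Sum>j<n. \<Phi> \<sigma> (\<sigma>(k := j)))
        \<le> c * (\<Sum>\<sigma>\<in>samples. \<Sum>j<n. \<Psi> \<sigma> (\<sigma>(k := j)))"
      unfolding sum_distrib_left[symmetric] sum.distrib
        sum_resample_swap[OF that, symmetric, of \<Phi>] sum_resample_swap[OF that, symmetric, of \<Psi>]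
      by (simp add: algebra_simps)
    also have "\<dots> \<le> c * (\<Sum>\<sigma>\<in>samples. \<Sum>j<n. 2 * M * (q \<sigma> (\<sigma> k) + q \<sigma> j))"
      unfolding \<Psi>_def q_def W_def using \<open>k < s\<close> \<open>0 \<le> c\<close>
      by (intro mult_left_mono sum_mono)
        (auto intro!: trace_diff_mat_square_le simp: samples_less)
    finally show ?thesis unfolding \<Phi>_def by simp
  qed
  have "real (n * s) * (\<Sum>\<sigma>\<in>samples. trace_mat (dev \<sigma> * dev \<sigma> ^\<^sub>m (2 * r + 1)))
      \<le> (\<Sum>k<s. c * (\<Sum>\<sigma>\<in>samples. \<Sum>j<n. 2 * M * (q \<sigma> (\<sigma> k) + q \<sigma> j)))"
    by (subst sum_dev_mult_exchange[OF pow_carrier_mat[OF dev_carrier]]) (intro sum_mono step, simp)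
  also have "\<dots> = 2 * M * c * (\<Sum>k<s. \<Sum>\<sigma>\<in>samples. \<Sum>j<n. q \<sigma> (\<sigma> k) + q \<sigma> j)"
    unfolding sum_distrib_left by (intro sum.cong refl) simp
  also have "(\<Sum>k<s. \<Sum>\<sigma>\<in>samples. \<Sum>j<n. q \<sigma> (\<sigma> k) + q \<sigma> j)
      = (\<Sum>\<sigma>\<in>samples. \<Sum>k<s. \<Sum>j<n. q \<sigma> (\<sigma> k) + q \<sigma> j)"
    by (rule sum.swap)
  \<comment> \<open>The empirical mean is \<open>dev \<sigma>\<close> plus \<Sigma>, and the average
    over \<open>j\<close> contributes a second \<Sigma>.\<close>
  also have "(\<Sum>\<sigma>\<in>samples. \<Sum>k<s. \<Sum>j<n. q \<sigma> (\<sigma> k) + q \<sigma> j)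
      = (\<Sum>\<sigma>\<in>samples. real (n * s) * (trace_mat (dev \<sigma> * W \<sigma>) + 2 * trace_mat (mean_mat * W \<sigma>)))"
    using n_pos s_pos
    by (intro sum.cong)
      (simp_all add: trace_dev_mult trace_mean_mat_mult sum.distrib q_def sum_distrib_left[symmetric] field_simps)
  also have "2 * M * c * \<dots> = real (n * s) *
      (2 * M * c * (\<Sum>\<sigma>\<in>samples. trace_mat (dev \<sigma> * W \<sigma>) + 2 * trace_mat (mean_mat * W \<sigma>)))"
    unfolding sum_distrib_left by (intro sum.cong refl) (simp only: mult_ac)
  finally have "(\<Sum>\<sigma>\<in>samples. trace_mat (dev \<sigma> * dev \<sigma> ^\<^sub>m (2 * r + 1)))
      \<le> 2 * M * c * (\<Sum>\<sigma>\<in>samples. trace_mat (dev \<sigma> * W \<sigma>) + 2 * trace_mat (mean_mat * W \<sigma>))"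
    using n_pos s_pos by simp
  then show ?thesis
    unfolding W_def dev_pow c_def by (simp del: pow_mat.simps)
qed

text \<open>With \<open>V\<close> the \<open>r\<close>-th power of the deviation, the left side sums
  the quadratic form of \<Sigma> over the rows of \<open>V\<close>; then \<Sigma> \<le> I, in the
  form \<open>mean_le\<close>, applies to each row.\<close>

lemma trace_mean_mat_pow_le:
  "trace_mat (mean_mat * dev \<sigma> ^\<^sub>m (2 * r)) \<le> trace_mat (dev \<sigma> ^\<^sub>m (2 * r))"
proof -
  define V where "V = dev \<sigma> ^\<^sub>m r"
  have V[simp]: "V \<in> carrier_mat N N" "transpose_mat V = V"
    unfolding V_def by (simp_all add: transpose_pow_mat[of _ N])
  have VV: "dev \<sigma> ^\<^sub>m (2 * r) = V * V"
    unfolding V_def by (simp add: mult_2 pow_mat_add[of _ N])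
  have "z j \<bullet> (V * V *\<^sub>v z j) = (\<Sum>i<N. (z j \<bullet> row V i)\<^sup>2)" for j
  proof -
    have "z j \<bullet> (V * V *\<^sub>v z j) = (V *\<^sub>v z j) \<bullet> (V *\<^sub>v z j)"
      using symmetric_mat_scalar_prod[of V N "z j" "V *\<^sub>v z j"] z_carrier
      by (simp add: assoc_mult_mat_vec[of _ N N _ N] mult_mat_vec_carrier[of _ N N])
    also have "\<dots> = (\<Sum>i<N. (row V i \<bullet> z j)\<^sup>2)"
      using carrier_matD[OF V(1)]
      by (simp add: scalar_prod_def[of "V *\<^sub>v z j"] power2_eq_square atLeast0LessThan)
    also have "\<dots> = (\<Sum>i<N. (z j \<bullet> row V i)\<^sup>2)"
      using z_carrier V(1) by (intro sum.cong refl arg_cong[where f = "\<lambda>x. x\<^sup>2"] comm_scalar_prod[of _ N]) auto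
    finally show ?thesis .
  qed
  then have "trace_mat (mean_mat * (V * V)) = (\<Sum>j<n. \<Sum>i<N. (z j \<bullet> row V i)\<^sup>2) / real n"
    by (simp add: trace_mean_mat_mult mult_square_carrier_mat del: assoc_mult_mat_vec)
  also have "\<dots> = (\<Sum>i<N. \<Sum>j<n. (z j \<bullet> row V i)\<^sup>2) / real n"
    by (subst sum.swap) (rule refl)
  also have "\<dots> \<le> (\<Sum>i<N. real n * (row V i \<bullet> row V i)) / real n"
    using V(1) by (intro divide_right_mono sum_mono mean_le) auto
  also have "\<dots> = (\<Sum>i<N. row V i \<bullet> row V i)"
    using n_pos by (simp add: sum_distrib_left[symmetric])
  also have "\<dots> = trace_mat (V * transpose_mat V)"
    using carrier_matD[OF V(1)] unfolding trace_mat_def by (auto intro!: sum.cong simp del: V(2))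
  finally show ?thesis unfolding VV by simp
qed

text \<open>\<open>trace_transpose_mult_le\<close> for \<open>X^(r + 1)\<close> and
  \<open>b X^r\<close>. Traces of odd powers have no definite sign, so the recursion trades them for
  the two even neighbours.\<close>

lemma trace_odd_le_even:
  "2 * b * trace_mat (dev \<sigma> ^\<^sub>m (2 * r + 1))
    \<le> trace_mat (dev \<sigma> ^\<^sub>m (2 * r + 2)) + b\<^sup>2 * trace_mat (dev \<sigma> ^\<^sub>m (2 * r))"
proof -
  define X where "X = dev \<sigma>"
  have X[simp]: "X \<in> carrier_mat N N" "transpose_mat X = X" unfolding X_def by simp_all
  have "transpose_mat (b \<cdot>\<^sub>m X ^\<^sub>m r) = b \<cdot>\<^sub>m X ^\<^sub>m r"
  proof -
    have "transpose_mat (b \<cdot>\<^sub>m X ^\<^sub>m r) = b \<cdot>\<^sub>m transpose_mat (X ^\<^sub>m r)"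
      by (rule eq_matI) auto
    then show ?thesis by (simp add: transpose_pow_mat[of _ N])
  qed
  moreover have "X ^\<^sub>m (r + 1) * (b \<cdot>\<^sub>m X ^\<^sub>m r) = b \<cdot>\<^sub>m X ^\<^sub>m (2 * r + 1)"
    using pow_mat_add[OF X(1), of "r + 1" r]
    by (simp add: mult_smult_distrib[of _ N N _ N] mult_2 del: pow_mat.simps)
  moreover have "(b \<cdot>\<^sub>m X ^\<^sub>m r) * (b \<cdot>\<^sub>m X ^\<^sub>m r) = b \<cdot>\<^sub>m (b \<cdot>\<^sub>m X ^\<^sub>m (2 * r))"
    using pow_mat_add[OF X(1), of r r]
    by (simp add: mult_smult_distrib[of _ N N _ N] mult_smult_assoc_mat[of _ N N _ N] mult_2)
  moreover have "X ^\<^sub>m (r + 1) * X ^\<^sub>m (r + 1) = X ^\<^sub>m (2 * r + 2)"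
    using pow_mat_add[OF X(1), of "r + 1" "r + 1"] by (simp add: mult_2 del: pow_mat.simps)
  moreover have "transpose_mat (X ^\<^sub>m (r + 1)) = X ^\<^sub>m (r + 1)"
    by (rule transpose_pow_mat[of _ N]) simp_all
  ultimately show ?thesis
    using trace_transpose_mult_le[of "X ^\<^sub>m (r + 1)" N N "b \<cdot>\<^sub>m X ^\<^sub>m r"]
    unfolding X_def[symmetric]
    by (simp add: trace_mat_smult[of _ N] power2_eq_square mult.assoc del: pow_mat.simps)
qed

section \<open>Moment recursion and tail bound\<close>

lemma trace_mean_mat: "trace_mat mean_mat = mean_trace"
proof -
  have "trace_mat (mean_mat * 1\<^sub>m N) = mean_trace"
    unfolding mean_trace_def using z_carrier by (subst trace_mean_mat_mult) simp_all
  then show ?thesis by (simp add: right_mult_one_mat[of _ N N])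
qed

lemma M_nonneg: "0 \<le> M"
  using z_bound[OF n_pos] scalar_prod_self_nonneg[of "z 0"] by simp

text \<open>The highest order \<open>p\<close> is fixed in advance, so that \<open>b\<close> bounds
  the factor of the recursion at every order up to \<open>p\<close>. Each step costs a factor
  \<open>5 * b\<close>.\<close>

lemma moment_bound:
  assumes b: "b = 4 * real p * M / real s" "b \<le> 1" and "Suc r \<le> p"
  shows "(\<Sum>\<sigma>\<in>samples. trace_mat (dev \<sigma> ^\<^sub>m (2 * Suc r)))
    \<le> (5 * b) ^ Suc r * (real (card samples) * mean_trace)"
  using \<open>Suc r \<le> p\<close>
proof (induction r)
  case 0
  have "0 \<le> mean_trace"
    unfolding mean_trace_def by (simp add: sum_nonneg scalar_prod_self_nonneg)
  \<comment> \<open>The first moment vanishes, so only the trace of \<Sigma> is left; a start at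
    exponent 0 would have brought in the dimension.\<close>
  have "(\<Sum>\<sigma>\<in>samples. trace_mat (dev \<sigma> ^\<^sub>m 2))
      \<le> 2 * M / real s * (\<Sum>\<sigma>\<in>samples. trace_mat (dev \<sigma>) + 2 * trace_mat mean_mat)"
    using sum_even_moment_le[of 0]
      left_mult_one_mat[OF dev_carrier] right_mult_one_mat[OF mean_mat_carrier] carrier_matD[OF dev_carrier]
    by (simp add: numeral_2_eq_2)
  also have "\<dots> = 4 * 1 * M / real s * (real (card samples) * mean_trace)"
    by (simp add: sum.distrib sum_trace_dev trace_mean_mat)
  also have "\<dots> \<le> 5 * b * (real (card samples) * mean_trace)"
  proof (rule mult_right_mono)
    have "4 * 1 * M / real s \<le> b"
      unfolding b using 0 M_nonneg s_pos by (intro divide_right_mono mult_right_mono) auto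
    moreover have "0 \<le> b" unfolding b using M_nonneg by simp
    ultimately show "4 * 1 * M / real s \<le> 5 * b" by simp
  qed (use \<open>0 \<le> mean_trace\<close> in simp)
  finally show ?case by simp
next
  case (Suc r)
  define q where "q = Suc r"
  define F where "F i = (\<Sum>\<sigma>\<in>samples. trace_mat (dev \<sigma> ^\<^sub>m i))" for i
  have "0 \<le> b" unfolding b using M_nonneg by simp
  have F_nonneg: "0 \<le> F (2 * q)"
    unfolding F_def using trace_transpose_mult_self_nonneg[of "dev _ ^\<^sub>m q" N N]
    by (intro sum_nonneg)
      (simp add: transpose_pow_mat[of _ N] pow_mat_add[OF dev_carrier, symmetric] mult_2)
  \<comment> \<open>The weight one half lets the leading term be absorbed into the left-hand side of
    the recursion.\<close>
  have half: "b * trace_mat (dev \<sigma> ^\<^sub>m (2 * q + 1))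
      \<le> (trace_mat (dev \<sigma> ^\<^sub>m (2 * q + 2)) + b\<^sup>2 * trace_mat (dev \<sigma> ^\<^sub>m (2 * q))) / 2" for \<sigma>
    using trace_odd_le_even[of b \<sigma> q] by (simp add: field_simps del: pow_mat.simps)
  have "F (2 * q + 2) \<le> 2 * M * real (2 * q + 1) / real s *
      (\<Sum>\<sigma>\<in>samples. trace_mat (dev \<sigma> ^\<^sub>m (2 * q + 1)) + 2 * trace_mat (mean_mat * dev \<sigma> ^\<^sub>m (2 * q)))"
    unfolding F_def by (rule sum_even_moment_le)
  also have "\<dots> \<le> b *
      (\<Sum>\<sigma>\<in>samples. trace_mat (dev \<sigma> ^\<^sub>m (2 * q + 1)) + 2 * trace_mat (mean_mat * dev \<sigma> ^\<^sub>m (2 * q)))"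
  proof (rule mult_right_mono)
    have "2 * M * real (2 * q + 1) \<le> 2 * M * (2 * real p)"
      using Suc.prems M_nonneg unfolding q_def by (intro mult_left_mono) auto
    then show "2 * M * real (2 * q + 1) / real s \<le> b"
      unfolding b using s_pos by (simp add: divide_right_mono mult_ac)
    \<comment> \<open>\<open>X\<close> itself need not be positive semidefinite, but
      \<open>X\<close> plus \<Sigma> is the empirical mean, so \<open>X\<close> plus twice \<Sigma>
      is.\<close>
    have "0 \<le> trace_mat (dev \<sigma> ^\<^sub>m (2 * q + 1)) + 2 * trace_mat (mean_mat * dev \<sigma> ^\<^sub>m (2 * q))" for \<sigma>
    proof -
      have "dev \<sigma> ^\<^sub>m (2 * q + 1) = dev \<sigma> * dev \<sigma> ^\<^sub>m (2 * q)"
        using pow_mat_add[OF dev_carrier, of \<sigma> 1 "2 * q"] by simp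
      then show ?thesis
        using quadratic_even_pow_nonneg[OF dev_carrier transpose_dev z_carrier]
        by (simp add: trace_dev_mult trace_mean_mat_mult sum_nonneg)
    qed
    then show "0 \<le> (\<Sum>\<sigma>\<in>samples. trace_mat (dev \<sigma> ^\<^sub>m (2 * q + 1)) + 2 * trace_mat (mean_mat * dev \<sigma> ^\<^sub>m (2 * q)))"
      by (rule sum_nonneg)
  qed
  also have "\<dots> = (\<Sum>\<sigma>\<in>samples. b * trace_mat (dev \<sigma> ^\<^sub>m (2 * q + 1)) + 2 * b * trace_mat (mean_mat * dev \<sigma> ^\<^sub>m (2 * q)))"
    by (simp add: sum_distrib_left algebra_simps)
  also have "\<dots> \<le> (\<Sum>\<sigma>\<in>samples. (trace_mat (dev \<sigma> ^\<^sub>m (2 * q + 2)) + b\<^sup>2 * trace_mat (dev \<sigma> ^\<^sub>m (2 * q))) / 2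
      + 2 * b * trace_mat (dev \<sigma> ^\<^sub>m (2 * q)))"
    using \<open>0 \<le> b\<close> by (intro sum_mono add_mono half mult_left_mono trace_mean_mat_pow_le) auto
  also have "\<dots> = (F (2 * q + 2) + b\<^sup>2 * F (2 * q)) / 2 + 2 * b * F (2 * q)"
    unfolding F_def by (simp add: sum.distrib sum_distrib_left sum_divide_distrib[symmetric])
  \<comment> \<open>Half of \<open>F (2 * q + 2)\<close> moves to the left; after that
    \<open>b \<le> 1\<close> replaces \<open>b * b + 4 * b\<close> by \<open>5 * b\<close>.\<close>
  finally have "F (2 * q + 2) \<le> (b * b + 4 * b) * F (2 * q)"
    by (simp add: power2_eq_square field_simps)
  also have "\<dots> \<le> 5 * b * F (2 * q)"
    using F_nonneg \<open>0 \<le> b\<close> \<open>b \<le> 1\<close> mult_left_mono[of b 1 b] by (intro mult_right_mono) auto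
  also have "\<dots> \<le> 5 * b * ((5 * b) ^ q * (real (card samples) * mean_trace))"
    using Suc.IH Suc.prems \<open>0 \<le> b\<close> unfolding F_def q_def
    by (intro mult_left_mono) (auto simp del: pow_mat.simps)
  finally show ?case unfolding F_def q_def by (simp add: mult.assoc del: pow_mat.simps)
qed

text \<open>Markov's inequality by counting: on a bad sample the trace of the \<open>2 p\<close>-th
  power exceeds \<open>\<eta> ^ (2 * p)\<close>, by contraposition of
  \<open>quadratic_form_le_of_trace_pow\<close>.\<close>

lemma card_large_deviation_le:
  assumes b: "b = 4 * real p * M / real s" "b \<le> 1" and "0 < p" and "0 < \<eta>"
  shows "real (card {\<sigma>\<in>samples. \<not> (\<forall>v\<in>carrier_vec N. \<bar>v \<bullet> (dev \<sigma> *\<^sub>v v)\<bar> \<le> \<eta> * (v \<bullet> v))})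
    \<le> (5 * b / \<eta>\<^sup>2) ^ p * mean_trace * real (card samples)"
    (is "real (card ?B) \<le> _")
proof -
  define f where "f \<sigma> = trace_mat (dev \<sigma> ^\<^sub>m (2 * p))" for \<sigma>
  have f_nonneg: "0 \<le> f \<sigma>" for \<sigma>
    unfolding f_def using trace_transpose_mult_self_nonneg[of "dev \<sigma> ^\<^sub>m p" N N]
    by (simp add: transpose_pow_mat[of _ N] pow_mat_add[OF dev_carrier, symmetric] mult_2)
  have "\<eta> ^ (2 * p) \<le> f \<sigma>" if "\<sigma> \<in> ?B" for \<sigma>
    using that quadratic_form_le_of_trace_pow[OF dev_carrier transpose_dev, of \<sigma> p \<eta>] \<open>0 < p\<close> \<open>0 < \<eta>\<close>
    unfolding f_def by fastforce
  then have "real (card ?B) * \<eta> ^ (2 * p) \<le> (\<Sum>\<sigma>\<in>?B. f \<sigma>)"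
    by (intro sum_bounded_below) auto
  also have "\<dots> \<le> (\<Sum>\<sigma>\<in>samples. f \<sigma>)"
    using f_nonneg by (intro sum_mono2) auto
  also have "\<dots> \<le> (5 * b) ^ p * (real (card samples) * mean_trace)"
    using moment_bound[OF b, of "p - 1"] \<open>0 < p\<close> unfolding f_def by simp
  finally show ?thesis
    unfolding power_divide power_mult using \<open>0 < \<eta>\<close>
    by (simp add: pos_le_divide_eq mult_ac)
qed

end

section \<open>Rayleigh quotients and the condition number\<close>

lemma vec_eq_if_minus_eq_0:
  fixes a b :: "'a :: ab_group_add vec"
  assumes "a \<in> carrier_vec d" "b \<in> carrier_vec d" "a - b = 0\<^sub>v d"
  shows "a = b"
proof (rule eq_vecI)
  fix i assume "i < dim_vec b"
  with assms have "(a - b) $ i = 0" "i < d" by auto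
  with assms(1,2) show "a $ i = b $ i" by simp
qed (use assms in simp)

lemma scalar_prod_self_eq_0_iff:
  assumes "v \<in> carrier_vec n"
  shows "v \<bullet> v = 0 \<longleftrightarrow> v = (0\<^sub>v n :: real vec)"
proof
  assume "v \<bullet> v = 0"
  then have "\<forall>i\<in>{0..<dim_vec v}. v $ i * v $ i = 0"
    using sum_nonneg_eq_0_iff[of "{0..<dim_vec v}" "\<lambda>i. v $ i * v $ i"]
    by (simp add: scalar_prod_def)
  with assms show "v = 0\<^sub>v n" by (intro eq_vecI) auto
qed (use assms in simp)

lemma scalar_prod_self_pos:
  assumes "v \<in> carrier_vec n" "v \<noteq> (0\<^sub>v n :: real vec)"
  shows "0 < v \<bullet> v"
  using scalar_prod_self_nonneg[of v] scalar_prod_self_eq_0_iff[OF assms(1)] assms(2) by linarith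

text \<open>Encoding the sphere by functions that vanish from \<open>d\<close> on makes the product
  topology available: the set is a closed part of a product of compact intervals.\<close>

lemma compact_unit_sphere_fun:
  "compact {f :: nat \<Rightarrow> real. (\<forall>i\<ge>d. f i = 0) \<and> (\<Sum>i<d. (f i)\<^sup>2) = 1}" (is "compact ?S")
proof -
  define K where "K = PiE UNIV (\<lambda>i. if i < d then {-1..1} else {0 :: real})"
  have "compact K"
    unfolding K_def compactin_euclidean_iff[symmetric] euclidean_product_topology[symmetric]
      compactin_PiE by auto
  moreover have "closed {f :: nat \<Rightarrow> real. (\<Sum>i<d. (f i)\<^sup>2) = 1}"
    by (intro closed_Collect_eq continuous_intros continuous_on_product_coordinates)
  moreover have "?S = K \<inter> {f. (\<Sum>i<d. (f i)\<^sup>2) = 1}"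
  proof (intro equalityI subsetI)
    fix f assume f: "f \<in> ?S"
    have "\<bar>f i\<bar> \<le> 1" if "i < d" for i
    proof -
      have "(f i)\<^sup>2 \<le> (\<Sum>i<d. (f i)\<^sup>2)" using that by (intro member_le_sum) auto
      with f show ?thesis by (simp add: abs_square_le_1)
    qed
    with f show "f \<in> K \<inter> {f. (\<Sum>i<d. (f i)\<^sup>2) = 1}"
      unfolding K_def by (auto simp: PiE_iff abs_le_iff minus_le_iff)
  next
    fix f assume f: "f \<in> K \<inter> {f. (\<Sum>i<d. (f i)\<^sup>2) = 1}"
    then have "f \<in> K" by simp
    from PiE_mem[OF this[unfolded K_def], of i for i] have "f i = 0" if "i \<ge> d" for i
      using that by (metis UNIV_I leD singletonD)
    with f show "f \<in> ?S" by auto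
  qed
  ultimately show ?thesis by (simp add: compact_Int_closed)
qed

lemma quadratic_form_add_smult:
  fixes S :: "real mat"
  assumes S: "S \<in> carrier_mat d d" "transpose_mat S = S"
    and v: "v \<in> carrier_vec d" and u: "u \<in> carrier_vec d"
  shows "(v + t \<cdot>\<^sub>v u) \<bullet> (S *\<^sub>v (v + t \<cdot>\<^sub>v u))
    = v \<bullet> (S *\<^sub>v v) + 2 * t * (u \<bullet> (S *\<^sub>v v)) + t\<^sup>2 * (u \<bullet> (S *\<^sub>v u))"
proof -
  have Sv: "S *\<^sub>v v \<in> carrier_vec d" and Su: "S *\<^sub>v u \<in> carrier_vec d"
    using S u v by (auto intro: mult_mat_vec_carrier)
  have "v \<bullet> (S *\<^sub>v u) = u \<bullet> (S *\<^sub>v v)"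
    using symmetric_mat_scalar_prod[OF S v u] comm_scalar_prod[OF Sv u] by simp
  then show ?thesis
    using S u v Su Sv
    by (simp add: mult_add_distrib_mat_vec[of _ d d] mult_mat_vec[of _ d d]
        add_scalar_prod_distrib[of _ d] scalar_prod_add_distrib[of _ d] algebra_simps power2_eq_square)
qed

text \<open>The maximiser of the Rayleigh quotient over the (compact) unit sphere is an eigenvector.\<close>

lemma exists_eigenvalue_ge_Rayleigh:
  fixes S :: "real mat"
  assumes S: "S \<in> carrier_mat d d" "transpose_mat S = S" and "0 < d"
  shows "\<exists>\<rho>. eigenvalue S \<rho> \<and> (\<forall>v\<in>carrier_vec d. v \<bullet> (S *\<^sub>v v) \<le> \<rho> * (v \<bullet> v))"
proof -
  define K where "K = {f :: nat \<Rightarrow> real. (\<forall>i\<ge>d. f i = 0) \<and> (\<Sum>i<d. (f i)\<^sup>2) = 1}"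
  define q where "q f = (\<Sum>i<d. \<Sum>j<d. f i * (S $$ (i, j) * f j))" for f :: "nat \<Rightarrow> real"
  have q_vec: "v \<bullet> (S *\<^sub>v v) = q (($) v)" if "v \<in> carrier_vec d" for v
    using that S
    by (auto simp: q_def scalar_prod_def sum_distrib_left atLeast0LessThan intro!: sum.cong)
  have "compact K" unfolding K_def by (rule compact_unit_sphere_fun)
  moreover have "(\<lambda>i. if i = 0 then 1 else 0) \<in> K"
    unfolding K_def using \<open>0 < d\<close> by (simp add: if_distrib[of "\<lambda>x. x\<^sup>2"] cong: if_cong)
  moreover have "continuous_on K q"
    unfolding q_def
    by (intro continuous_intros continuous_on_subset[OF continuous_on_product_coordinates] subset_UNIV)
  ultimately obtain f where f: "f \<in> K" and f_max: "\<And>g. g \<in> K \<Longrightarrow> q g \<le> q f"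
    using continuous_attains_sup[of K q] by blast
  define \<rho> where "\<rho> = q f"
  define v where "v = vec d f"
  have v: "v \<in> carrier_vec d" unfolding v_def by simp
  have v_unit: "v \<bullet> v = 1"
    using f unfolding v_def K_def by (simp add: scalar_prod_def power2_eq_square atLeast0LessThan)
  have q_cong: "q f = q g" if "\<And>i. i < d \<Longrightarrow> f i = g i" for f g
    unfolding q_def using that by (intro sum.cong) auto
  have v_val: "v \<bullet> (S *\<^sub>v v) = \<rho>"
    unfolding q_vec[OF v] \<rho>_def by (rule q_cong) (simp add: v_def)
  have bound: "u \<bullet> (S *\<^sub>v u) \<le> \<rho> * (u \<bullet> u)" if u: "u \<in> carrier_vec d" for u
  proof (cases "u = 0\<^sub>v d")
    case True
    then show ?thesis using S by (simp add: mult_mat_vec_carrier[of _ d d])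
  next
    case False
    then have pos: "0 < u \<bullet> u" by (rule scalar_prod_self_pos[OF u])
    define r where "r = 1 / sqrt (u \<bullet> u)"
    have r2: "r\<^sup>2 = 1 / (u \<bullet> u)" unfolding r_def using pos by (simp add: power_divide)
    define g where "g i = (if i < d then r * u $ i else 0)" for i
    have "(\<Sum>i<d. (g i)\<^sup>2) = r\<^sup>2 * (u \<bullet> u)"
      using u by (simp add: g_def scalar_prod_def sum_distrib_left power2_eq_square mult_ac atLeast0LessThan)
    then have "g \<in> K" unfolding K_def using pos r2 by (simp add: g_def)
    from f_max[OF this] have "q g \<le> \<rho>" unfolding \<rho>_def .
    moreover have "q g = r\<^sup>2 * q (($) u)"
      unfolding q_def sum_distrib_left by (intro sum.cong) (auto simp: g_def power2_eq_square)
    ultimately show ?thesis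
      using pos unfolding q_vec[OF u] r2 by (simp add: field_simps)
  qed
  \<comment> \<open>The residual of the eigenvalue equation, which also serves as the direction of
    variation.\<close>
  define w where "w = S *\<^sub>v v - \<rho> \<cdot>\<^sub>v v"
  have Sv: "S *\<^sub>v v \<in> carrier_vec d" using S v by (auto intro: mult_mat_vec_carrier)
  have w: "w \<in> carrier_vec d" unfolding w_def using Sv v by simp
  define Q where "Q = \<rho> * (w \<bullet> w) - w \<bullet> (S *\<^sub>v w)"
  have "0 \<le> Q" unfolding Q_def using bound[OF w] by simp
  have ww: "w \<bullet> (S *\<^sub>v v) - \<rho> * (w \<bullet> v) = w \<bullet> w"
    using Sv v w scalar_prod_minus_distrib[OF w Sv, of "\<rho> \<cdot>\<^sub>v v"] unfolding w_def[symmetric] by simp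
  have variation: "2 * t * (w \<bullet> w) \<le> t\<^sup>2 * Q" for t
  proof -
    have "(v + t \<cdot>\<^sub>v w) \<bullet> (S *\<^sub>v (v + t \<cdot>\<^sub>v w)) \<le> \<rho> * ((v + t \<cdot>\<^sub>v w) \<bullet> (v + t \<cdot>\<^sub>v w))"
      using v w by (intro bound) simp
    moreover have "(v + t \<cdot>\<^sub>v w) \<bullet> (v + t \<cdot>\<^sub>v w) = 1 + 2 * t * (w \<bullet> v) + t\<^sup>2 * (w \<bullet> w)"
      using quadratic_form_add_smult[of "1\<^sub>m d" d v w t] v w v_unit by simp
    ultimately show ?thesis
      using ww unfolding quadratic_form_add_smult[OF S v w] v_val Q_def
      by (simp add: algebra_simps)
  qed
  have "w \<bullet> w = 0"
  proof (rule ccontr)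
    assume "w \<bullet> w \<noteq> 0"
    with scalar_prod_self_nonneg[of w] have R: "0 < w \<bullet> w" by simp
    \<comment> \<open>Small enough for the linear term in \<open>variation\<close> to dominate; the
      \<open>1\<close> in the denominator covers \<open>Q = 0\<close>.\<close>
    define t where "t = (w \<bullet> w) / (Q + 1)"
    have "0 < t" unfolding t_def using R \<open>0 \<le> Q\<close> by simp
    have "t * Q < w \<bullet> w" unfolding t_def using R \<open>0 \<le> Q\<close> by (simp add: field_simps)
    with \<open>0 < t\<close> have "t * (t * Q) < t * (2 * (w \<bullet> w))" using R by (intro mult_strict_left_mono) auto
    with variation[of t] show False by (simp add: power2_eq_square mult_ac)
  qed
  then have "w = 0\<^sub>v d" using scalar_prod_self_eq_0_iff[OF w] by simp
  then have "S *\<^sub>v v = \<rho> \<cdot>\<^sub>v v"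
    using vec_eq_if_minus_eq_0[OF Sv, of "\<rho> \<cdot>\<^sub>v v"] v unfolding w_def by simp
  moreover have "v \<noteq> 0\<^sub>v d" using v_unit v by auto
  ultimately have "eigenvector S v \<rho>" unfolding eigenvector_def using S v by simp
  then show ?thesis using bound unfolding eigenvalue_def by blast
qed

text \<open>The form of \<open>H\<close> lies between its extreme eigenvalues times the squared
  norm. As \<open>H\<close> is positive definite, these eigenvalues are also singular values, so
  their ratio is at most the condition number.\<close>

lemma norm2_le_of_quadratic_form_le:
  fixes H :: "real mat"
  assumes H: "H \<in> carrier_mat d d" "transpose_mat H = H" and "0 < d" and "0 < \<gamma>"
    and pd: "\<And>v. v \<in> carrier_vec d \<Longrightarrow> \<gamma> * (v \<bullet> v) \<le> v \<bullet> (H *\<^sub>v v)"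
    and u: "u \<in> carrier_vec d" and v: "v \<in> carrier_vec d" and "0 \<le> c"
    and le: "u \<bullet> (H *\<^sub>v u) \<le> c\<^sup>2 * (v \<bullet> (H *\<^sub>v v))"
  shows "norm2 u \<le> c * sqrt (cond_number H) * norm2 v"
proof -
  have HH: "H * H \<in> carrier_mat d d" using H by simp
  have sing: "\<rho> \<in> singular_values H" if "eigenvalue H \<rho>" "0 \<le> \<rho>" for \<rho>
  proof -
    from that obtain w where w: "w \<in> carrier_vec d" "w \<noteq> 0\<^sub>v d" "H *\<^sub>v w = \<rho> \<cdot>\<^sub>v w"
      using H unfolding eigenvalue_def eigenvector_def by auto
    then have "H * H *\<^sub>v w = (\<rho> * \<rho>) \<cdot>\<^sub>v w"
      using H by (simp add: assoc_mult_mat_vec[of _ d d _ d] mult_mat_vec[of _ d d] smult_smult_assoc)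
    then have "eigenvalue (H * H) (\<rho> * \<rho>)"
      unfolding eigenvalue_def eigenvector_def using w H by auto
    then show ?thesis
      unfolding singular_values_def spectrum_def H(2) using \<open>0 \<le> \<rho>\<close>
      by (intro image_eqI[of _ _ "\<rho> * \<rho>"]) auto
  qed
  have sing_pos: "0 < \<sigma>" if "\<sigma> \<in> singular_values H" for \<sigma>
  proof -
    from that obtain \<mu> where \<mu>: "\<sigma> = sqrt \<mu>" "eigenvalue (H * H) \<mu>"
      unfolding singular_values_def spectrum_def H(2) by auto
    then obtain w where w: "w \<in> carrier_vec d" "w \<noteq> 0\<^sub>v d" "H * H *\<^sub>v w = \<mu> \<cdot>\<^sub>v w"
      using H unfolding eigenvalue_def eigenvector_def by auto
    have Hw: "H *\<^sub>v w \<in> carrier_vec d" using H w by (auto intro: mult_mat_vec_carrier)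
    have ww: "0 < w \<bullet> w" using w by (intro scalar_prod_self_pos)
    have "H *\<^sub>v w \<noteq> 0\<^sub>v d"
    proof
      assume "H *\<^sub>v w = 0\<^sub>v d"
      then have "\<gamma> * (w \<bullet> w) \<le> 0" using pd[OF w(1)] w(1) by simp
      with ww \<open>0 < \<gamma>\<close> show False by (simp add: mult_le_0_iff)
    qed
    then have "0 < (H *\<^sub>v w) \<bullet> (H *\<^sub>v w)" using Hw by (intro scalar_prod_self_pos)
    also have "(H *\<^sub>v w) \<bullet> (H *\<^sub>v w) = w \<bullet> (H * H *\<^sub>v w)"
      using symmetric_mat_scalar_prod[OF H w(1) Hw] H w by (simp add: assoc_mult_mat_vec[of _ d d _ d])
    also have "\<dots> = \<mu> * (w \<bullet> w)" unfolding w(3) using w(1) by simp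
    finally show ?thesis using ww \<mu> by (simp add: zero_less_mult_iff)
  qed
  have fin: "finite (singular_values H)"
    unfolding singular_values_def H(2) using card_finite_spectrum[OF HH] by simp
  obtain \<rho>1 where \<rho>1: "eigenvalue H \<rho>1" "\<And>w. w \<in> carrier_vec d \<Longrightarrow> w \<bullet> (H *\<^sub>v w) \<le> \<rho>1 * (w \<bullet> w)"
    using exists_eigenvalue_ge_Rayleigh[OF H \<open>0 < d\<close>] by blast
  \<comment> \<open>The least eigenvalue is minus the greatest eigenvalue of
    \<open>- H\<close>.\<close>
  have "- H \<in> carrier_mat d d" "transpose_mat (- H) = - H"
    using H by (auto simp: transpose_uminus)
  from exists_eigenvalue_ge_Rayleigh[OF this \<open>0 < d\<close>]
  obtain \<mu> where \<mu>: "eigenvalue (- H) \<mu>" "\<And>w. w \<in> carrier_vec d \<Longrightarrow> w \<bullet> (- H *\<^sub>v w) \<le> \<mu> * (w \<bullet> w)"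
    by blast
  have neg: "- H *\<^sub>v w = - (H *\<^sub>v w)" if "w \<in> carrier_vec d" for w
    using that H by (intro uminus_mult_mat_vec) auto
  define \<rho>2 where "\<rho>2 = - \<mu>"
  have \<rho>2_le: "\<rho>2 * (w \<bullet> w) \<le> w \<bullet> (H *\<^sub>v w)" if "w \<in> carrier_vec d" for w
    using \<mu>(2)[OF that] that H unfolding \<rho>2_def neg[OF that] by (simp add: scalar_prod_uminus_right)
  have "eigenvalue H \<rho>2"
  proof -
    from \<mu>(1) obtain w where w: "w \<in> carrier_vec d" "w \<noteq> 0\<^sub>v d" "- H *\<^sub>v w = \<mu> \<cdot>\<^sub>v w"
      using H unfolding eigenvalue_def eigenvector_def by auto
    have "H *\<^sub>v w = \<rho>2 \<cdot>\<^sub>v w"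
    proof (rule eq_vecI)
      fix i assume "i < dim_vec (\<rho>2 \<cdot>\<^sub>v w)"
      then have "i < d" using w by simp
      then have "(- H *\<^sub>v w) $ i = (\<mu> \<cdot>\<^sub>v w) $ i" using w(3) by simp
      then show "(H *\<^sub>v w) $ i = (\<rho>2 \<cdot>\<^sub>v w) $ i"
        using \<open>i < d\<close> H w(1) unfolding neg[OF w(1)] \<rho>2_def by simp
    qed (use H w in simp)
    then show ?thesis unfolding eigenvalue_def eigenvector_def using w H by auto
  qed
  have eig_pos: "0 < \<rho>" if "eigenvalue H \<rho>" for \<rho>
  proof -
    from that obtain w where w: "w \<in> carrier_vec d" "w \<noteq> 0\<^sub>v d" "H *\<^sub>v w = \<rho> \<cdot>\<^sub>v w"
      using H unfolding eigenvalue_def eigenvector_def by auto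
    have ww: "0 < w \<bullet> w" using w by (intro scalar_prod_self_pos)
    have "0 < \<gamma> * (w \<bullet> w)" using ww \<open>0 < \<gamma>\<close> by simp
    also have "\<dots> \<le> \<rho> * (w \<bullet> w)" using pd[OF w(1)] w by simp
    finally show ?thesis using ww by (simp add: zero_less_mult_iff)
  qed
  have mem: "\<rho>1 \<in> singular_values H" "\<rho>2 \<in> singular_values H"
    using sing eig_pos \<rho>1(1) \<open>eigenvalue H \<rho>2\<close> by (auto simp: less_imp_le)
  have pos: "0 < \<rho>1" "0 < \<rho>2" using eig_pos \<rho>1(1) \<open>eigenvalue H \<rho>2\<close> by auto
  have Min_pos: "0 < Min (singular_values H)"
    using fin mem sing_pos by (subst Min_gr_iff) auto
  have Max_nonneg: "0 \<le> Max (singular_values H)"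
    using Max_ge[OF fin mem(1)] pos(1) by simp
  have cond: "\<rho>1 / \<rho>2 \<le> cond_number H"
    unfolding cond_number_def using fin mem pos Min_pos Max_nonneg by (intro frac_le) auto
  have "\<rho>2 * (u \<bullet> u) \<le> u \<bullet> (H *\<^sub>v u)" by (rule \<rho>2_le[OF u])
  also note le
  also have "c\<^sup>2 * (v \<bullet> (H *\<^sub>v v)) \<le> c\<^sup>2 * (\<rho>1 * (v \<bullet> v))"
    using \<rho>1(2)[OF v] by (intro mult_left_mono) auto
  finally have "u \<bullet> u \<le> c\<^sup>2 * (\<rho>1 / \<rho>2) * (v \<bullet> v)"
    using pos by (simp add: field_simps)
  also have "\<dots> \<le> c\<^sup>2 * cond_number H * (v \<bullet> v)"
    using cond scalar_prod_self_nonneg[of v] by (intro mult_right_mono mult_left_mono) auto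
  finally have "sqrt (u \<bullet> u) \<le> sqrt (c\<^sup>2 * cond_number H * (v \<bullet> v))" by simp
  then show ?thesis unfolding norm2_def using \<open>0 \<le> c\<close> by (simp add: real_sqrt_mult)
qed

section \<open>Ridge Hessians and the inexact Newton iteration\<close>

lemma ridge_hessian_carrier:
  "B \<in> carrier_mat m d \<Longrightarrow> ridge_hessian \<gamma> B \<in> carrier_mat d d"
  unfolding ridge_hessian_def by auto

lemma transpose_ridge_hessian:
  assumes "B \<in> carrier_mat m d"
  shows "transpose_mat (ridge_hessian \<gamma> B) = ridge_hessian \<gamma> B"
  using assms unfolding ridge_hessian_def
  by (intro eq_matI) (auto intro!: comm_scalar_prod[of _ m])

lemma ridge_hessian_form:
  assumes B: "B \<in> carrier_mat m d" and u: "u \<in> carrier_vec d" and v: "v \<in> carrier_vec d"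
  shows "u \<bullet> (ridge_hessian \<gamma> B *\<^sub>v v)
    = (\<Sum>k<m. (row B k \<bullet> u) * (row B k \<bullet> v)) / real m + \<gamma> * (u \<bullet> v)"
proof -
  have smult: "c \<cdot>\<^sub>m M *\<^sub>v v = c \<cdot>\<^sub>v (M *\<^sub>v v)" if "M \<in> carrier_mat d d" for c :: real and M
    using that v by (intro eq_vecI) auto
  have Bv: "B *\<^sub>v v \<in> carrier_vec m" using B v by (auto intro: mult_mat_vec_carrier)
  have BBv: "transpose_mat B *\<^sub>v (B *\<^sub>v v) \<in> carrier_vec d"
    using B Bv by (auto intro: mult_mat_vec_carrier)
  have "ridge_hessian \<gamma> B *\<^sub>v v
      = (1 / real m) \<cdot>\<^sub>v (transpose_mat B *\<^sub>v (B *\<^sub>v v)) + \<gamma> \<cdot>\<^sub>v v"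
    using B v unfolding ridge_hessian_def
    by (simp add: add_mult_distrib_mat_vec[of _ d d] smult assoc_mult_mat_vec[of _ d m _ d]
        mult_carrier_mat[of _ d m _ d])
  then have "u \<bullet> (ridge_hessian \<gamma> B *\<^sub>v v)
      = (u \<bullet> (transpose_mat B *\<^sub>v (B *\<^sub>v v))) / real m + \<gamma> * (u \<bullet> v)"
    using u v BBv by (simp add: scalar_prod_add_distrib[of _ d])
  also have "u \<bullet> (transpose_mat B *\<^sub>v (B *\<^sub>v v)) = (B *\<^sub>v v) \<bullet> (B *\<^sub>v u)"
    using transpose_vec_mult_scalar[OF B u Bv] comm_scalar_prod[OF u BBv] by simp
  also have "\<dots> = (\<Sum>k<m. (row B k \<bullet> u) * (row B k \<bullet> v))"
    using B by (simp add: scalar_prod_def[of "B *\<^sub>v v"] atLeast0LessThan mult.commute)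
  finally show ?thesis .
qed

lemma ridge_hessian_ge:
  assumes "B \<in> carrier_mat m d" "v \<in> carrier_vec d"
  shows "\<gamma> * (v \<bullet> v) \<le> v \<bullet> (ridge_hessian \<gamma> B *\<^sub>v v)"
  unfolding ridge_hessian_form[OF assms assms(2)] by (simp add: sum_nonneg)

section \<open>Inverses and pseudoinverses\<close>

lemma positive_definite_inverse:
  fixes H :: "real mat"
  assumes H: "H \<in> carrier_mat d d"
    and pd: "\<And>v. v \<in> carrier_vec d \<Longrightarrow> v \<noteq> 0\<^sub>v d \<Longrightarrow> 0 < v \<bullet> (H *\<^sub>v v)"
  obtains G where "mat_inverse H = Some G" "G \<in> carrier_mat d d" "H * G = 1\<^sub>m d" "G * H = 1\<^sub>m d"
proof -
  have "det H \<noteq> 0"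
  proof
    assume "det H = 0"
    then obtain v where v: "v \<in> carrier_vec d" "v \<noteq> 0\<^sub>v d" "H *\<^sub>v v = 0\<^sub>v d"
      using det_0_iff_vec_prod_zero[OF H] by blast
    with pd[of v] show False by simp
  qed
  then have "H \<in> Units (ring_mat TYPE(real) d ())"
    by (rule det_non_zero_imp_unit[OF H])
  with mat_inverse(1)[OF H] obtain G where "mat_inverse H = Some G" by fastforce
  with mat_inverse(2)[OF H this] that show ?thesis by blast
qed

text \<open>Multiplying \<open>M * Y * M = M\<close> by \<open>X\<close> on both sides forces
  \<open>Y = X\<close>. This makes the leverage scores computable from the inverse of the
  Hessian.\<close>

lemma pseudoinverse_eq_inverse:
  assumes M: "M \<in> carrier_mat d d" and X: "X \<in> carrier_mat d d"
    and inv: "M * X = 1\<^sub>m d" "X * M = 1\<^sub>m d"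
  shows "pseudoinverse M = X"
  unfolding pseudoinverse_def
proof (rule the_equality)
  show "is_pseudoinverse M X"
    unfolding is_pseudoinverse_def inv using M X by auto
next
  fix Y assume "is_pseudoinverse M Y"
  then have Y: "Y \<in> carrier_mat d d" and MYM: "M * Y * M = M"
    unfolding is_pseudoinverse_def using M by auto
  have "Y = (X * M) * Y * (M * X)" unfolding inv using Y by simp
  also have "\<dots> = X * (M * Y * M) * X"
    using M X Y by (simp add: assoc_mult_square_mat[of _ d] mult_square_carrier_mat)
  also have "\<dots> = X" unfolding MYM inv(2) using X by simp
  finally show "Y = X" .
qed

section \<open>Quadratic objectives and Newton steps\<close>

lemma deriv_quadratic_0: "deriv (\<lambda>h. a + h * b + h\<^sup>2 * c) (0::real) = b"
  by (rule DERIV_imp_deriv) (auto intro!: derivative_eq_intros)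

text \<open>Abstracts from losses and data: the analysis of the iteration uses only a quadratic with
  constant Hessian bounded below by \<gamma>.\<close>

locale quadratic_objective =
  fixes d :: nat and F :: "real vec \<Rightarrow> real" and H :: "real mat" and g :: "real vec" and c \<gamma> :: real
  assumes H: "H \<in> carrier_mat d d" "transpose_mat H = H"
    and g: "g \<in> carrier_vec d"
    and F: "w \<in> carrier_vec d \<Longrightarrow> F w = w \<bullet> (H *\<^sub>v w) / 2 + g \<bullet> w + c"
    and \<gamma>_pos: "0 < \<gamma>"
    and H_ge: "v \<in> carrier_vec d \<Longrightarrow> \<gamma> * (v \<bullet> v) \<le> v \<bullet> (H *\<^sub>v v)"
begin

lemma H_vec[simp]: "w \<in> carrier_vec d \<Longrightarrow> H *\<^sub>v w \<in> carrier_vec d"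
  using H by (auto intro: mult_mat_vec_carrier)

text \<open>The exact Taylor expansion of \<open>F\<close> along \<open>u\<close>. Its linear
  coefficient yields the gradient, and at a critical point it yields minimality.\<close>

lemma F_add_smult:
  assumes w: "w \<in> carrier_vec d" and u: "u \<in> carrier_vec d"
  shows "F (w + h \<cdot>\<^sub>v u) = F w + h * (u \<bullet> (H *\<^sub>v w + g)) + h\<^sup>2 * (u \<bullet> (H *\<^sub>v u) / 2)"
  using w u g comm_scalar_prod[OF g u]
  by (simp add: F quadratic_form_add_smult[OF H w u] scalar_prod_add_distrib[of _ d] field_simps)

lemma grad_eq:
  assumes "w \<in> carrier_vec d"
  shows "grad d F w = H *\<^sub>v w + g"
proof (rule eq_vecI)
  fix i assume "i < dim_vec (H *\<^sub>v w + g)"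
  then have i: "i < d" using g by simp
  then have "grad d F w $ i = unit_vec d i \<bullet> (H *\<^sub>v w + g)"
    by (simp only: grad_def index_vec F_add_smult[OF assms unit_vec_carrier] deriv_quadratic_0)
  then show "grad d F w $ i = (H *\<^sub>v w + g) $ i"
    using i assms g by (subst (asm) scalar_prod_left_unit[of _ d]) simp_all
qed (use g in \<open>simp add: grad_def\<close>)

lemma hessian_eq:
  assumes w: "w \<in> carrier_vec d"
  shows "hessian d F w = H"
proof (rule eq_matI)
  fix i k assume "i < dim_row H" "k < dim_col H"
  then have ik: "i < d" "k < d" using H by auto
  have "vec_index (grad d F (w + h \<cdot>\<^sub>v unit_vec d k)) i = (H *\<^sub>v w + g) $ i + h * H $$ (i, k) + h\<^sup>2 * 0" for h
    using w g H ik
    by (simp add: grad_eq mult_add_distrib_mat_vec[of _ d d] mult_mat_vec[of _ d d])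
  then show "hessian d F w $$ (i, k) = H $$ (i, k)"
    using ik by (simp add: hessian_def deriv_quadratic_0[of _ _ 0, simplified])
qed (use H in \<open>auto simp: hessian_def\<close>)

lemma exists_inverse:
  obtains G where "mat_inverse H = Some G" "G \<in> carrier_mat d d" "H * G = 1\<^sub>m d" "G * H = 1\<^sub>m d"
proof (rule positive_definite_inverse[OF H(1)])
  fix v :: "real vec" assume v: "v \<in> carrier_vec d" "v \<noteq> 0\<^sub>v d"
  then have "0 < \<gamma> * (v \<bullet> v)" using \<gamma>_pos scalar_prod_self_pos by simp
  with H_ge[OF v(1)] show "0 < v \<bullet> (H *\<^sub>v v)" by simp
qed (rule that)

text \<open>Take minus the inverse of \<open>H\<close> applied to \<open>g\<close>. Around this
  critical point \<open>F\<close> grows by half the squared energy norm of the displacement.\<close>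

lemma minimizer:
  obtains ws where "ws \<in> carrier_vec d" "H *\<^sub>v ws + g = 0\<^sub>v d"
    "\<And>w. is_arg_min F (\<lambda>w. w \<in> carrier_vec d) w \<longleftrightarrow> w = ws"
proof -
  obtain G where G: "G \<in> carrier_mat d d" "H * G = 1\<^sub>m d" by (rule exists_inverse)
  define ws where "ws = - (G *\<^sub>v g)"
  have Gg: "G *\<^sub>v g \<in> carrier_vec d" using G g by (auto intro: mult_mat_vec_carrier)
  then have ws: "ws \<in> carrier_vec d" unfolding ws_def by simp
  have "ws = (-1) \<cdot>\<^sub>v (G *\<^sub>v g)" unfolding ws_def by (intro eq_vecI) auto
  then have "H *\<^sub>v ws = (-1) \<cdot>\<^sub>v (H *\<^sub>v (G *\<^sub>v g))"
    using H Gg by (simp add: mult_mat_vec[of _ d d])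
  also have "H *\<^sub>v (G *\<^sub>v g) = g"
    using assoc_mult_mat_vec[OF H(1) G(1) g] g unfolding G(2) by simp
  finally have "H *\<^sub>v ws = (-1) \<cdot>\<^sub>v g" .
  then have crit: "H *\<^sub>v ws + g = 0\<^sub>v d" using g by (intro eq_vecI) auto
  have F_ws: "F w = F ws + (w - ws) \<bullet> (H *\<^sub>v (w - ws)) / 2" if w: "w \<in> carrier_vec d" for w
  proof -
    have "w = ws + 1 \<cdot>\<^sub>v (w - ws)" using w ws by (intro eq_vecI) auto
    then have "F w = F (ws + 1 \<cdot>\<^sub>v (w - ws))" by simp
    also have "\<dots> = F ws + (w - ws) \<bullet> (H *\<^sub>v (w - ws)) / 2"
      using w ws by (subst F_add_smult) (simp_all add: crit)
    finally show ?thesis .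
  qed
  have less: "F ws < F w" if w: "w \<in> carrier_vec d" "w \<noteq> ws" for w
  proof -
    have "w - ws \<in> carrier_vec d" "w - ws \<noteq> 0\<^sub>v d"
      using w ws vec_eq_if_minus_eq_0[of w d ws] by auto
    then have "0 < \<gamma> * ((w - ws) \<bullet> (w - ws))" using \<gamma>_pos scalar_prod_self_pos by simp
    with H_ge[of "w - ws"] F_ws[OF w(1)] w ws show ?thesis by simp
  qed
  have "is_arg_min F (\<lambda>w. w \<in> carrier_vec d) w \<longleftrightarrow> w = ws" for w
    unfolding is_arg_min_def using less ws by (metis less_asym less_irrefl)
  with that ws crit show ?thesis by blast
qed

text \<open>The error of the inexact Newton step is \<open>y = M\<inverse> (M - H) e\<close>; testing \<open>M y = (M - H) e\<close>
  with \<open>y\<close> bounds it in the energy norm of \<open>H\<close>.\<close>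

lemma newton_step_contracts:
  assumes M: "M \<in> carrier_mat d d" "transpose_mat M = M"
    and M_inv: "mat_inverse M = Some K"
    and close: "\<And>u. u \<in> carrier_vec d \<Longrightarrow>
      \<bar>u \<bullet> (M *\<^sub>v u) - u \<bullet> (H *\<^sub>v u)\<bar> \<le> \<epsilon> / 2 * (u \<bullet> (H *\<^sub>v u))"
    and \<epsilon>: "0 < \<epsilon>" "\<epsilon> < 1 / 4" and e: "e \<in> carrier_vec d"
  defines "y \<equiv> e - K *\<^sub>v (H *\<^sub>v e)"
  shows "y \<bullet> (H *\<^sub>v y) \<le> \<epsilon>\<^sup>2 * (e \<bullet> (H *\<^sub>v e))"
proof -
  have K: "K \<in> carrier_mat d d" "M * K = 1\<^sub>m d"
    using mat_inverse(2)[OF M(1) M_inv] by auto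
  have KHe: "K *\<^sub>v (H *\<^sub>v e) \<in> carrier_vec d"
    using K e by (auto intro: mult_mat_vec_carrier)
  have y: "y \<in> carrier_vec d" unfolding y_def using e KHe by simp
  have M_vec[simp]: "M *\<^sub>v w \<in> carrier_vec d" if "w \<in> carrier_vec d" for w
    using M that by (auto intro: mult_mat_vec_carrier)
  have My: "M *\<^sub>v y = M *\<^sub>v e - H *\<^sub>v e"
  proof -
    have "M *\<^sub>v (K *\<^sub>v (H *\<^sub>v e)) = H *\<^sub>v e"
      using assoc_mult_mat_vec[OF M(1) K(1) H_vec[OF e]] e unfolding K(2) by simp
    then show ?thesis
      unfolding y_def using M e KHe by (simp add: mult_minus_distrib_mat_vec[of _ d d])
  qed
  have yMy: "y \<bullet> (M *\<^sub>v y) = y \<bullet> (M *\<^sub>v e) - y \<bullet> (H *\<^sub>v e)"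
    unfolding My using y e by (simp add: scalar_prod_minus_distrib[of _ d])
  define qe qy where "qe = e \<bullet> (H *\<^sub>v e)" and "qy = y \<bullet> (H *\<^sub>v y)"
  have "0 \<le> v \<bullet> (H *\<^sub>v v)" if "v \<in> carrier_vec d" for v
    using H_ge[OF that] \<gamma>_pos scalar_prod_self_nonneg[of v]
    by (meson less_imp_le mult_nonneg_nonneg order_trans)
  then have nonneg: "0 \<le> qe" "0 \<le> qy" unfolding qe_def qy_def using e y by auto
  define x where "x = y \<bullet> (M *\<^sub>v e) - y \<bullet> (H *\<^sub>v e)"
  \<comment> \<open>polarisation of the perturbation bound at \<open>y \<plusminus> \<epsilon> e\<close>\<close>
  have pol: "4 * \<epsilon> * x \<le> \<epsilon> * (qy + \<epsilon>\<^sup>2 * qe)"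
  proof -
    \<comment> \<open>The terms even in \<open>t\<close>, which cancel between
      \<open>t = \<epsilon>\<close> and \<open>t = - \<epsilon>\<close>. Scaling \<open>e\<close> by
      \<epsilon> is what produces the factor \<open>\<epsilon>\<^sup>2\<close> in front of
      \<open>qe\<close>.\<close>
    define a where "a = y \<bullet> (M *\<^sub>v y) - qy + \<epsilon>\<^sup>2 * (e \<bullet> (M *\<^sub>v e) - qe)"
    have form: "\<bar>a + 2 * t * x\<bar> \<le> \<epsilon> / 2 * (qy + 2 * t * (e \<bullet> (H *\<^sub>v y)) + \<epsilon>\<^sup>2 * qe)"
      if "t\<^sup>2 = \<epsilon>\<^sup>2" for t
    proof -
      have "e \<bullet> (M *\<^sub>v y) = y \<bullet> (M *\<^sub>v e)" "e \<bullet> (H *\<^sub>v y) = y \<bullet> (H *\<^sub>v e)"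
        using symmetric_mat_scalar_prod[OF M e y] symmetric_mat_scalar_prod[OF H e y]
          comm_scalar_prod[of "M *\<^sub>v e" d y] comm_scalar_prod[of "H *\<^sub>v e" d y] e y by auto
      then show ?thesis
        using close[of "y + t \<cdot>\<^sub>v e"] y e that
        unfolding quadratic_form_add_smult[OF M y e] quadratic_form_add_smult[OF H y e] a_def x_def qe_def qy_def
        by (simp add: algebra_simps)
    qed
    show ?thesis
      using abs_le_D1[OF form[of \<epsilon>]] abs_le_D2[OF form[of "- \<epsilon>"]] by (simp add: algebra_simps)
  qed
  have "4 * x \<le> qy + \<epsilon>\<^sup>2 * qe" using pol \<epsilon> by simp
  moreover have "(1 - \<epsilon> / 2) * qy \<le> x"
    using abs_le_D2[OF close[OF y]] yMy unfolding x_def qy_def by (simp add: algebra_simps)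
  moreover have "7 / 8 * qy \<le> (1 - \<epsilon> / 2) * qy"
    using \<epsilon> nonneg by (intro mult_right_mono) auto
  moreover have "0 \<le> \<epsilon>\<^sup>2 * qe" using nonneg by simp
  \<comment> \<open>Together, \<open>7 / 2 * qy \<le> qy + \<epsilon>\<^sup>2 * qe\<close>, which is
    stronger than the claim.\<close>
  ultimately show ?thesis
    unfolding qe_def[symmetric] qy_def[symmetric] by linarith
qed

text \<open>The contraction is iterated in the energy norm, and norms are exchanged only at the end;
  hence the condition number enters once and not at every step.\<close>

lemma newton_iter_error:
  assumes M: "M \<in> carrier_mat d d" "transpose_mat M = M"
    and close: "\<And>u. u \<in> carrier_vec d \<Longrightarrow>
      \<bar>u \<bullet> (M *\<^sub>v u) - u \<bullet> (H *\<^sub>v u)\<bar> \<le> \<epsilon> / 2 * (u \<bullet> (H *\<^sub>v u))"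
    and \<epsilon>: "0 < \<epsilon>" "\<epsilon> < 1 / 4" and "0 < d"
    and ws: "ws \<in> carrier_vec d" "H *\<^sub>v ws + g = 0\<^sub>v d" and w0: "w0 \<in> carrier_vec d"
  shows "norm2 (newton_iter d F M w0 t - ws) \<le> \<epsilon> ^ t * sqrt (cond_number H) * norm2 (w0 - ws)"
proof -
  \<comment> \<open>A relative error below \<open>1 / 8\<close> preserves positive definiteness, so
    \<open>mat_inverse M\<close> is not \<open>None\<close>.\<close>
  have "0 < v \<bullet> (M *\<^sub>v v)" if v: "v \<in> carrier_vec d" "v \<noteq> 0\<^sub>v d" for v
  proof -
    have pos: "0 < v \<bullet> (H *\<^sub>v v)"
      using H_ge[OF v(1)] \<gamma>_pos scalar_prod_self_pos[OF v] by (meson less_le_trans mult_pos_pos)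
    have "\<epsilon> / 2 * (v \<bullet> (H *\<^sub>v v)) \<le> 1 / 8 * (v \<bullet> (H *\<^sub>v v))"
      using \<epsilon> pos by (intro mult_right_mono) auto
    with close[OF v(1)] pos show ?thesis by linarith
  qed
  then obtain K where K: "mat_inverse M = Some K" "K \<in> carrier_mat d d"
    using positive_definite_inverse[OF M(1)] by metis
  define w where "w t = newton_iter d F M w0 t" for t
  have "w t \<in> carrier_vec d \<and>
      (w t - ws) \<bullet> (H *\<^sub>v (w t - ws)) \<le> (\<epsilon> ^ t)\<^sup>2 * ((w0 - ws) \<bullet> (H *\<^sub>v (w0 - ws)))"
  proof (induction t)
    case 0
    then show ?case unfolding w_def using w0 by simp
  next
    case (Suc t)
    then have wt: "w t \<in> carrier_vec d" by simp
    define e where "e = w t - ws"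
    have e: "e \<in> carrier_vec d" unfolding e_def using wt ws by simp
    have KHe: "K *\<^sub>v (H *\<^sub>v e) \<in> carrier_vec d"
      using K e by (auto intro: mult_mat_vec_carrier)
    \<comment> \<open>Criticality of \<open>ws\<close> turns the gradient at \<open>w t\<close> into
      \<open>H\<close> applied to the error.\<close>
    have "H *\<^sub>v w t + g = H *\<^sub>v e"
    proof (rule eq_vecI)
      fix i assume "i < dim_vec (H *\<^sub>v e)"
      then have i: "i < d" using carrier_vecD[OF H_vec[OF e]] by simp
      have "(H *\<^sub>v ws + g) $ i = 0" unfolding ws(2) using i by simp
      moreover have "H *\<^sub>v e = H *\<^sub>v w t - H *\<^sub>v ws"
        unfolding e_def using H wt ws by (simp add: mult_minus_distrib_mat_vec[of _ d d])
      ultimately show "(H *\<^sub>v w t + g) $ i = (H *\<^sub>v e) $ i"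
        using i H g by simp
    qed (use g e carrier_matD[OF H(1)] in simp)
    then have step: "w (Suc t) = w t - K *\<^sub>v (H *\<^sub>v e)"
      unfolding w_def by (simp add: K(1) grad_eq[OF wt[unfolded w_def]])
    then have "w (Suc t) \<in> carrier_vec d" using wt KHe by simp
    moreover have "w t - r - ws = e - r" if "r \<in> carrier_vec d" for r
      unfolding e_def using wt ws(1) that by (intro eq_vecI) auto
    from this[OF KHe] have "(w (Suc t) - ws) \<bullet> (H *\<^sub>v (w (Suc t) - ws)) \<le> \<epsilon>\<^sup>2 * (e \<bullet> (H *\<^sub>v e))"
      using newton_step_contracts[OF M K(1) close \<epsilon> e] unfolding step by simp
    moreover have "\<epsilon>\<^sup>2 * (e \<bullet> (H *\<^sub>v e))
        \<le> \<epsilon>\<^sup>2 * ((\<epsilon> ^ t)\<^sup>2 * ((w0 - ws) \<bullet> (H *\<^sub>v (w0 - ws))))"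
      using Suc unfolding e_def by (intro mult_left_mono) auto
    ultimately show ?case by (simp add: power_mult_distrib mult.assoc)
  qed
  then show ?thesis
    unfolding w_def using ws w0 \<epsilon>
    by (intro norm2_le_of_quadratic_form_le[OF H \<open>0 < d\<close> \<gamma>_pos H_ge]) auto
qed

end

section \<open>Concentration of the sub-sampled Hessian\<close>

lemma quadratic_form_outer_square:
  fixes z v :: "real vec"
  assumes "z \<in> carrier_vec N" "v \<in> carrier_vec N"
  shows "z \<bullet> (outer_square v *\<^sub>v z) = (z \<bullet> v)\<^sup>2"
proof -
  have "z \<bullet> (outer_square v *\<^sub>v z) = (\<Sum>a<N. \<Sum>b<N. (z $ a * v $ a) * (z $ b * v $ b))"
    using assms by (subst quadratic_form_eq_sum[of _ N]) (auto simp: outer_square_def intro!: sum.cong)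
  also have "\<dots> = (z \<bullet> v)\<^sup>2"
    using assms by (simp add: scalar_prod_def power2_eq_square sum_product atLeast0LessThan)
  finally show ?thesis .
qed

context rank_one_sampling begin

lemma quadratic_form_dev:
  assumes v: "v \<in> carrier_vec N"
  shows "v \<bullet> (dev \<sigma> *\<^sub>v v) = (\<Sum>k<s. (z (\<sigma> k) \<bullet> v)\<^sup>2) / real s - (\<Sum>j<n. (z j \<bullet> v)\<^sup>2) / real n"
proof -
  have "v \<bullet> (dev \<sigma> *\<^sub>v v) = trace_mat (outer_square v * dev \<sigma>)"
    by (rule trace_outer_square_mult[OF dev_carrier v, symmetric])
  also have "\<dots> = trace_mat (dev \<sigma> * outer_square v)"
    by (rule trace_mat_comm[of _ N N]) (simp_all add: v)
  finally show ?thesis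
    by (simp add: trace_dev_mult v quadratic_form_outer_square[OF z_carrier v])
qed

text \<open>The sampling distribution is uniform on \<open>samples\<close>, so the counting bound is
  a probability bound. The event \<open>P\<close> is arbitrary, to admit any consequence of a small
  deviation.\<close>

lemma prob_deviation_le:
  assumes "b = 4 * real p * M / real s" "b \<le> 1" "0 < p" "0 < \<eta>"
    and good: "\<And>\<sigma>. \<sigma> \<in> samples \<Longrightarrow> (\<And>v. v \<in> carrier_vec N \<Longrightarrow> \<bar>v \<bullet> (dev \<sigma> *\<^sub>v v)\<bar> \<le> \<eta> * (v \<bullet> v)) \<Longrightarrow> P \<sigma>"
  shows "1 - (5 * b / \<eta>\<^sup>2) ^ p * mean_trace \<le> measure_pmf.prob (uniform_sampling n s) {\<sigma>. P \<sigma>}"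
proof -
  define bad where "bad = {\<sigma>\<in>samples. \<not> (\<forall>v\<in>carrier_vec N. \<bar>v \<bullet> (dev \<sigma> *\<^sub>v v)\<bar> \<le> \<eta> * (v \<bullet> v))}"
  have sampling: "uniform_sampling n s = pmf_of_set samples"
    unfolding uniform_sampling_def samples_def using n_pos by (intro Pi_pmf_of_set) auto
  have "(\<lambda>k. 0) \<in> samples" unfolding samples_def PiE_dflt_def using n_pos by auto
  then have ne: "samples \<noteq> {}" and card_pos: "0 < real (card samples)"
    by (auto simp: card_gt_0_iff)
  have "bad \<subseteq> samples" unfolding bad_def by auto
  then have "real (card (samples - bad)) = real (card samples) - real (card bad)"
    by (subst card_Diff_subset) (auto simp: card_mono finite_subset[OF _ finite_samples])
  also have "\<dots> \<ge> real (card samples) - (5 * b / \<eta>\<^sup>2) ^ p * mean_trace * real (card samples)"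
    using card_large_deviation_le[OF assms(1-4)] unfolding bad_def by simp
  finally have "(1 - (5 * b / \<eta>\<^sup>2) ^ p * mean_trace) * real (card samples) \<le> real (card (samples - bad))"
    by (simp add: algebra_simps)
  also have "\<dots> \<le> real (card (samples \<inter> {\<sigma>. P \<sigma>}))"
    unfolding bad_def using good by (intro of_nat_mono card_mono) auto
  finally show ?thesis
    unfolding sampling using ne card_pos
    by (simp add: measure_pmf_of_set pos_le_divide_eq)
qed

end

text \<open>The regularised Gram matrix is \<open>n\<close> times the ridge Hessian, so its
  pseudoinverse is \<open>G\<close> divided by \<open>n\<close>.\<close>

lemma ridge_leverage_eq:
  assumes A: "A \<in> carrier_mat n d" and "0 < n"
    and G: "G \<in> carrier_mat d d" "ridge_hessian \<gamma> A * G = 1\<^sub>m d" "G * ridge_hessian \<gamma> A = 1\<^sub>m d"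
    and "j < n"
  shows "real n * ridge_leverage \<gamma> A j = row A j \<bullet> (G *\<^sub>v row A j)"
proof -
  define H where "H = ridge_hessian \<gamma> A"
  have H: "H \<in> carrier_mat d d" unfolding H_def by (rule ridge_hessian_carrier[OF A])
  have "transpose_mat A * A + (real n * \<gamma>) \<cdot>\<^sub>m 1\<^sub>m d = real n \<cdot>\<^sub>m H"
    using A \<open>0 < n\<close> unfolding H_def ridge_hessian_def by (intro eq_matI) (auto simp: field_simps)
  moreover have "pseudoinverse (real n \<cdot>\<^sub>m H) = (1 / real n) \<cdot>\<^sub>m G"
  proof (rule pseudoinverse_eq_inverse)
    have "(a \<cdot>\<^sub>m X) * (c \<cdot>\<^sub>m Y) = (a * c) \<cdot>\<^sub>m (X * Y)"
      if "X \<in> carrier_mat d d" "Y \<in> carrier_mat d d" for a c :: real and X Y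
      using that by (intro eq_matI) (auto simp: row_smult col_smult)
    then show "real n \<cdot>\<^sub>m H * (1 / real n \<cdot>\<^sub>m G) = 1\<^sub>m d" "1 / real n \<cdot>\<^sub>m G * (real n \<cdot>\<^sub>m H) = 1\<^sub>m d"
      using H G \<open>0 < n\<close> unfolding H_def[symmetric] by (auto intro!: eq_matI)
  qed (use H G in auto)
  moreover have "(1 / real n) \<cdot>\<^sub>m G *\<^sub>v row A j = (1 / real n) \<cdot>\<^sub>v (G *\<^sub>v row A j)"
    using A G(1) by (intro eq_vecI) auto
  moreover have "row A j \<in> carrier_vec d" "G *\<^sub>v row A j \<in> carrier_vec d"
    using A G(1) \<open>j < n\<close> by (auto intro!: mult_mat_vec_carrier)
  ultimately show ?thesis
    unfolding ridge_leverage_def using A \<open>0 < n\<close> by simp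
qed

text \<open>A rectangular substitute for the square root of the Hessian: \<open>A / \<surd>n\<close> stacked on \<open>\<surd>\<gamma> I\<close>.\<close>

definition ridge_factor :: "real \<Rightarrow> real mat \<Rightarrow> real mat" where
  "ridge_factor \<gamma> A = mat (dim_row A + dim_col A) (dim_col A) (\<lambda>(i, j).
     if i < dim_row A then A $$ (i, j) / sqrt (real (dim_row A))
     else if i - dim_row A = j then sqrt \<gamma> else 0)"

section \<open>Reduction to rank-one sampling\<close>

lemma sum_lessThan_add:
  fixes m n :: nat
  shows "(\<Sum>i<m + n. f i) = (\<Sum>i<m. f i) + (\<Sum>i<n. f (m + i) :: 'a :: comm_monoid_add)"
  by (induction n) (auto simp: add.assoc)

lemma ridge_factor_carrier:
  "A \<in> carrier_mat n d \<Longrightarrow> ridge_factor \<gamma> A \<in> carrier_mat (n + d) d"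
  unfolding ridge_factor_def by auto

lemma ridge_factor_form:
  assumes A: "A \<in> carrier_mat n d" and "0 < \<gamma>" and u: "u \<in> carrier_vec d" and v: "v \<in> carrier_vec d"
  shows "(ridge_factor \<gamma> A *\<^sub>v u) \<bullet> (ridge_factor \<gamma> A *\<^sub>v v) = u \<bullet> (ridge_hessian \<gamma> A *\<^sub>v v)"
proof -
  define B where "B = ridge_factor \<gamma> A"
  have top: "row B i \<bullet> w = (row A i \<bullet> w) / sqrt (real n)" if "i < n" "w \<in> carrier_vec d" for i w
    using that A unfolding B_def ridge_factor_def
    by (auto simp: scalar_prod_def sum_divide_distrib intro!: sum.cong)
  have bottom: "row B (n + i) \<bullet> w = sqrt \<gamma> * w $ i" if "i < d" "w \<in> carrier_vec d" for i w
  proof -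
    have "row B (n + i) = sqrt \<gamma> \<cdot>\<^sub>v unit_vec d i"
      using that A unfolding B_def ridge_factor_def by (intro eq_vecI) auto
    then show ?thesis using that by simp
  qed
  have "(B *\<^sub>v u) \<bullet> (B *\<^sub>v v) = (\<Sum>i<n + d. (row B i \<bullet> u) * (row B i \<bullet> v))"
    using ridge_factor_carrier[OF A, of \<gamma>] unfolding B_def[symmetric]
    by (simp add: scalar_prod_def[of "B *\<^sub>v u"] atLeast0LessThan)
  also have "\<dots> = (\<Sum>i<n. (row A i \<bullet> u) * (row A i \<bullet> v) / real n) + (\<Sum>i<d. \<gamma> * (u $ i * v $ i))"
    unfolding sum_lessThan_add using u v \<open>0 < \<gamma>\<close>
    by (intro arg_cong2[where f = "(+)"] sum.cong) (auto simp: top bottom)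
  also have "\<dots> = u \<bullet> (ridge_hessian \<gamma> A *\<^sub>v v)"
    unfolding ridge_hessian_form[OF A u v] using v
    by (simp add: sum_divide_distrib sum_distrib_left scalar_prod_def[of u v] atLeast0LessThan)
  finally show ?thesis unfolding B_def .
qed

lemma sample_rows_form:
  assumes A: "A \<in> carrier_mat n d" and "\<And>k. k < s \<Longrightarrow> \<sigma> k < n" and u: "u \<in> carrier_vec d"
  shows "u \<bullet> (ridge_hessian \<gamma> (sample_rows A s \<sigma>) *\<^sub>v u)
    = (\<Sum>k<s. (row A (\<sigma> k) \<bullet> u)\<^sup>2) / real s + \<gamma> * (u \<bullet> u)"
proof -
  have S: "sample_rows A s \<sigma> \<in> carrier_mat s d"
    unfolding sample_rows_def using A by auto
  have "row (sample_rows A s \<sigma>) k = row A (\<sigma> k)" if "k < s" for k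
    unfolding sample_rows_def using A that by (subst mat_of_rows_row) auto
  then show ?thesis
    unfolding ridge_hessian_form[OF S u u] by (simp add: power2_eq_square)
qed

text \<open>Whitening: with \<open>z j = B G a_j\<close>, the inner product of \<open>z j\<close>
  and \<open>B u\<close> is that of \<open>a_j\<close> and \<open>u\<close>. So the form of
  \<open>dev\<close> at \<open>B u\<close> is the error of the sub-sampled Hessian at
  \<open>u\<close>, while the squared norm of \<open>B u\<close> is the form of \<open>H\<close> at
  \<open>u\<close>.\<close>

lemma prob_ridge_hessian_close:
  assumes A: "A \<in> carrier_mat n d" and n: "0 < n" and s: "0 < s" and \<gamma>: "0 < \<gamma>"
  defines "M \<equiv> ridge_coherence \<gamma> A * eff_dim \<gamma> A"
  shows "0 \<le> M" "0 \<le> eff_dim \<gamma> A"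
    "\<And>p \<eta> P. 0 < p \<Longrightarrow> 4 * real p * M / real s \<le> 1 \<Longrightarrow> 0 < \<eta> \<Longrightarrow>
      (\<And>\<sigma>. (\<And>u. u \<in> carrier_vec d \<Longrightarrow>
        \<bar>u \<bullet> (ridge_hessian \<gamma> (sample_rows A s \<sigma>) *\<^sub>v u) - u \<bullet> (ridge_hessian \<gamma> A *\<^sub>v u)\<bar>
          \<le> \<eta> * (u \<bullet> (ridge_hessian \<gamma> A *\<^sub>v u))) \<Longrightarrow> P \<sigma>) \<Longrightarrow>
      1 - (5 * (4 * real p * M / real s) / \<eta>\<^sup>2) ^ p * eff_dim \<gamma> A \<le> measure_pmf.prob (uniform_sampling n s) {\<sigma>. P \<sigma>}"
proof -
  define H where "H = ridge_hessian \<gamma> A"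
  have H: "H \<in> carrier_mat d d" "transpose_mat H = H"
    unfolding H_def by (rule ridge_hessian_carrier[OF A] transpose_ridge_hessian[OF A])+
  have H_ge: "\<gamma> * (v \<bullet> v) \<le> v \<bullet> (H *\<^sub>v v)" if "v \<in> carrier_vec d" for v
    unfolding H_def by (rule ridge_hessian_ge[OF A that])
  have "0 < v \<bullet> (H *\<^sub>v v)" if "v \<in> carrier_vec d" "v \<noteq> 0\<^sub>v d" for v
    using H_ge[OF that(1)] \<gamma> scalar_prod_self_pos[OF that] by (meson less_le_trans mult_pos_pos)
  then obtain G where G: "G \<in> carrier_mat d d" "H * G = 1\<^sub>m d" "G * H = 1\<^sub>m d"
    using positive_definite_inverse[OF H(1)] by metis
  have G_vec: "G *\<^sub>v w \<in> carrier_vec d" if "w \<in> carrier_vec d" for w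
    using G(1) that by (auto intro: mult_mat_vec_carrier)
  have HG: "H *\<^sub>v (G *\<^sub>v w) = w" if "w \<in> carrier_vec d" for w
    using assoc_mult_mat_vec[OF H(1) G(1) that] that unfolding G(2) by simp
  define B where "B = ridge_factor \<gamma> A"
  have B: "B \<in> carrier_mat (n + d) d" unfolding B_def by (rule ridge_factor_carrier[OF A])
  have B_vec: "B *\<^sub>v w \<in> carrier_vec (n + d)" if "w \<in> carrier_vec d" for w
    using B that by (auto intro: mult_mat_vec_carrier)
  have B_form: "(B *\<^sub>v u) \<bullet> (B *\<^sub>v v) = u \<bullet> (H *\<^sub>v v)"
    if "u \<in> carrier_vec d" "v \<in> carrier_vec d" for u v
    unfolding B_def H_def by (rule ridge_factor_form[OF A \<gamma> that])
  have a: "row A j \<in> carrier_vec d" if "j < n" for j using A that by auto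
  \<comment> \<open>The default zero vector puts \<open>z j\<close> into the carrier for every
    \<open>j\<close>, as the sampling locale demands.\<close>
  define z where "z j = (if j < n then B *\<^sub>v (G *\<^sub>v row A j) else 0\<^sub>v (n + d))" for j
  have z: "z j \<in> carrier_vec (n + d)" for j
    unfolding z_def using a B_vec G_vec by auto
  have z_B: "z j \<bullet> (B *\<^sub>v u) = row A j \<bullet> u" if "j < n" "u \<in> carrier_vec d" for j u
  proof -
    have "z j \<bullet> (B *\<^sub>v u) = (H *\<^sub>v (G *\<^sub>v row A j)) \<bullet> u"
      using that a[OF that(1)] G_vec by (simp add: z_def B_form symmetric_mat_scalar_prod[OF H])
    then show ?thesis using HG[OF a[OF that(1)]] by simp
  qed
  have z_norm: "z j \<bullet> z j = real n * ridge_leverage \<gamma> A j" if "j < n" for j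
  proof -
    have "z j \<bullet> z j = row A j \<bullet> (G *\<^sub>v row A j)"
      using z_B[OF that G_vec[OF a[OF that]]] that unfolding z_def by simp
    then show ?thesis
      using ridge_leverage_eq[OF A n G(1), of \<gamma> j] G(2,3) that unfolding H_def by simp
  qed
  have lev_nonneg: "0 \<le> ridge_leverage \<gamma> A j" if "j < n" for j
    using z_norm[OF that] scalar_prod_self_nonneg[of "z j"] n by (simp add: zero_le_mult_iff)
  have dim_A: "dim_row A = n" using A by simp
  show eff_nonneg: "0 \<le> eff_dim \<gamma> A"
    unfolding eff_dim_def dim_A using lev_nonneg by (intro sum_nonneg) simp
  define L where "L = Max (ridge_leverage \<gamma> A ` {..<n})"
  have lev_le: "ridge_leverage \<gamma> A j \<le> L" if "j < n" for j
    unfolding L_def using that by (intro Max_ge) auto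
  \<comment> \<open>If the effective dimension is 0, the coherence divides by zero, but then all
    leverage scores vanish and both sides are 0.\<close>
  have M_eq: "M = real n * L"
  proof (cases "eff_dim \<gamma> A = 0")
    case True
    then have "ridge_leverage \<gamma> A j = 0" if "j < n" for j
      using that lev_nonneg unfolding eff_dim_def dim_A
      by (subst (asm) sum_nonneg_eq_0_iff) auto
    then have "ridge_leverage \<gamma> A ` {..<n} = {0}" using n by auto
    then show ?thesis unfolding M_def L_def True by simp
  next
    case False
    then show ?thesis unfolding M_def L_def ridge_coherence_def dim_A by simp
  qed
  interpret rank_one_sampling "n + d" n s z M
  proof
    fix v :: "real vec" assume v: "v \<in> carrier_vec (n + d)"
    \<comment> \<open>The least-squares solution: \<open>B u\<close> is the orthogonal projection of
      \<open>v\<close> onto the range of \<open>B\<close>. Hence the form of \<open>H\<close> at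
      \<open>u\<close>, which is the squared norm of \<open>B u\<close>, is at most that of
      \<open>v\<close>.\<close>
    define u where "u = G *\<^sub>v (transpose_mat B *\<^sub>v v)"
    have Bv: "transpose_mat B *\<^sub>v v \<in> carrier_vec d"
      using B v by (auto intro: mult_mat_vec_carrier)
    have u: "u \<in> carrier_vec d" unfolding u_def by (rule G_vec[OF Bv])
    have Hu: "H *\<^sub>v u = transpose_mat B *\<^sub>v v" unfolding u_def by (rule HG[OF Bv])
    have v_B: "v \<bullet> (B *\<^sub>v w) = (H *\<^sub>v u) \<bullet> w" if "w \<in> carrier_vec d" for w
      unfolding Hu by (rule transpose_vec_mult_scalar[OF B that v, symmetric])
    have zv: "z j \<bullet> v = row A j \<bullet> u" if "j < n" for j
    proof -
      have "z j \<bullet> v = v \<bullet> (B *\<^sub>v (G *\<^sub>v row A j))"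
        using comm_scalar_prod[OF z[of j] v] that by (simp add: z_def)
      also have "\<dots> = u \<bullet> row A j"
        using v_B[OF G_vec[OF a[OF that]]] symmetric_mat_scalar_prod[OF H u G_vec[OF a[OF that]]]
          HG[OF a[OF that]] by simp
      finally show ?thesis using comm_scalar_prod[OF u a[OF that]] by simp
    qed
    have "(\<Sum>j<n. (z j \<bullet> v)\<^sup>2) / real n \<le> u \<bullet> (H *\<^sub>v u)"
      unfolding H_def ridge_hessian_form[OF A u u]
      using \<gamma> scalar_prod_self_nonneg[of u] by (simp add: zv power2_eq_square)
    also have "\<dots> \<le> v \<bullet> v"
    proof -
      have "v \<bullet> (B *\<^sub>v u) = (B *\<^sub>v u) \<bullet> (B *\<^sub>v u)"
        using v_B[OF u] symmetric_mat_scalar_prod[OF H u u] B_form[OF u u] by simp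
      then show ?thesis
        using scalar_prod_am_gm[OF v B_vec[OF u], of 1] B_form[OF u u] by simp
    qed
    finally show "(\<Sum>j<n. (z j \<bullet> v)\<^sup>2) \<le> real n * (v \<bullet> v)"
      using n by (simp add: field_simps)
  qed (use n s z z_norm lev_le M_eq in \<open>auto intro: mult_left_mono\<close>)
  show "0 \<le> M" by (rule M_nonneg)
  have mean_trace_eq: "mean_trace = eff_dim \<gamma> A"
    unfolding mean_trace_def eff_dim_def dim_A using n by (simp add: z_norm sum_distrib_left[symmetric])
  fix p :: nat and \<eta> :: real and P
  assume p: "0 < p" and b: "4 * real p * M / real s \<le> 1" and \<eta>: "0 < \<eta>"
    and good: "\<And>\<sigma>. (\<And>u. u \<in> carrier_vec d \<Longrightarrow>
        \<bar>u \<bullet> (ridge_hessian \<gamma> (sample_rows A s \<sigma>) *\<^sub>v u) - u \<bullet> (ridge_hessian \<gamma> A *\<^sub>v u)\<bar>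
          \<le> \<eta> * (u \<bullet> (ridge_hessian \<gamma> A *\<^sub>v u))) \<Longrightarrow> P \<sigma>"
  show "1 - (5 * (4 * real p * M / real s) / \<eta>\<^sup>2) ^ p * eff_dim \<gamma> A
      \<le> measure_pmf.prob (uniform_sampling n s) {\<sigma>. P \<sigma>}"
    unfolding mean_trace_eq[symmetric]
  proof (rule prob_deviation_le[OF refl b p \<eta>], rule good)
    fix \<sigma> and u :: "real vec"
    assume \<sigma>: "\<sigma> \<in> samples" and u: "u \<in> carrier_vec d"
      and dev_le: "\<And>v. v \<in> carrier_vec (n + d) \<Longrightarrow> \<bar>v \<bullet> (dev \<sigma> *\<^sub>v v)\<bar> \<le> \<eta> * (v \<bullet> v)"
    have "(B *\<^sub>v u) \<bullet> (dev \<sigma> *\<^sub>v (B *\<^sub>v u))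
        = (\<Sum>k<s. (row A (\<sigma> k) \<bullet> u)\<^sup>2) / real s - (\<Sum>j<n. (row A j \<bullet> u)\<^sup>2) / real n"
      using z_B u samples_less[OF \<sigma>] by (simp add: quadratic_form_dev[OF B_vec[OF u]])
    also have "\<dots> = u \<bullet> (ridge_hessian \<gamma> (sample_rows A s \<sigma>) *\<^sub>v u) - u \<bullet> (ridge_hessian \<gamma> A *\<^sub>v u)"
      using sample_rows_form[OF A samples_less[OF \<sigma>] u] ridge_hessian_form[OF A u u]
      by (simp add: power2_eq_square)
    finally show "\<bar>u \<bullet> (ridge_hessian \<gamma> (sample_rows A s \<sigma>) *\<^sub>v u) - u \<bullet> (ridge_hessian \<gamma> A *\<^sub>v u)\<bar>
        \<le> \<eta> * (u \<bullet> (ridge_hessian \<gamma> A *\<^sub>v u))"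
      using dev_le[OF B_vec[OF u]] unfolding B_form[OF u u] H_def by simp
  qed
qed

section \<open>The regularised objective, the moment order and the conclusion\<close>

lemma convex_quadratic_form:
  assumes "convex_quadratic l"
  obtains b c where "0 \<le> deriv (deriv l) 0"
    "\<And>z. l z = deriv (deriv l) 0 * z\<^sup>2 / 2 + b * z + c"
proof -
  from assms obtain a b c where l: "\<And>z. l z = a * z\<^sup>2 + b * z + c" and conv: "convex_on UNIV l"
    unfolding convex_quadratic_def by blast
  have l_eq: "l = (\<lambda>z. a * z\<^sup>2 + b * z + c)" using l by auto
  have "(l has_real_derivative 2 * a * z + b) (at z)" for z
    unfolding l_eq by (auto intro!: derivative_eq_intros)
  then have "deriv l = (\<lambda>z. 2 * a * z + b)" by (auto intro!: DERIV_imp_deriv)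
  moreover have "((\<lambda>z. 2 * a * z + b) has_real_derivative 2 * a) (at 0)"
    by (auto intro!: derivative_eq_intros)
  ultimately have d2: "deriv (deriv l) 0 = 2 * a" by (simp add: DERIV_imp_deriv)
  \<comment> \<open>Midpoint convexity at -1 and 1: the linear terms cancel.\<close>
  have "0 \<le> a"
    using convex_onD[OF conv, of "1 / 2" "-1" 1] by (simp add: l field_simps)
  with that[of b c] d2 l show ?thesis by simp
qed

text \<open>Weighting the rows by the square root of the second derivative, nonnegative by
  convexity, makes the Gram matrix of the data reproduce the quadratic terms of the losses; their
  linear terms form \<open>g\<close>.\<close>

lemma quadratic_objective_data_mat:
  assumes x: "\<forall>j<n. x j \<in> carrier_vec d" and l: "\<forall>j<n. convex_quadratic (l j)" and "0 < \<gamma>"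
  shows "data_mat n d x l \<in> carrier_mat n d"
    "\<exists>g c. quadratic_objective d (objective n x l \<gamma>) (ridge_hessian \<gamma> (data_mat n d x l)) g c \<gamma>"
proof -
  define A where "A = data_mat n d x l"
  define H where "H = ridge_hessian \<gamma> A"
  define r where "r j = deriv (deriv (l j)) 0" for j
  have A: "A \<in> carrier_mat n d" unfolding A_def data_mat_def by auto
  then show "data_mat n d x l \<in> carrier_mat n d" unfolding A_def .
  have row: "row A j = sqrt (r j) \<cdot>\<^sub>v x j" if "j < n" for j
    unfolding A_def data_mat_def r_def using that x by (subst mat_of_rows_row) auto
  have "\<forall>j. \<exists>b c. j < n \<longrightarrow> 0 \<le> r j \<and> (\<forall>z. l j z = r j * z\<^sup>2 / 2 + b * z + c)"
    using l convex_quadratic_form unfolding r_def by metis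
  then obtain b c where r: "\<And>j. j < n \<Longrightarrow> 0 \<le> r j"
    and l_eq: "\<And>j z. j < n \<Longrightarrow> l j z = r j * z\<^sup>2 / 2 + b j * z + c j"
    by metis
  define g where "g = vec d (\<lambda>i. (\<Sum>j<n. b j * x j $ i) / real n)"
  have "objective n x l \<gamma> w = w \<bullet> (H *\<^sub>v w) / 2 + g \<bullet> w + (\<Sum>j<n. c j) / real n"
    if w: "w \<in> carrier_vec d" for w
  proof -
    have "g \<bullet> w = (\<Sum>i<d. \<Sum>j<n. b j * (x j $ i * w $ i) / real n)"
      using w unfolding g_def
      by (auto simp: scalar_prod_def sum_divide_distrib sum_distrib_right atLeast0LessThan mult.assoc
          intro!: sum.cong)
    also have "\<dots> = (\<Sum>j<n. \<Sum>i<d. b j * (x j $ i * w $ i) / real n)" by (rule sum.swap)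
    also have "\<dots> = (\<Sum>j<n. b j * (x j \<bullet> w)) / real n"
      using w by (simp add: scalar_prod_def sum_divide_distrib sum_distrib_left atLeast0LessThan)
    finally have gw: "g \<bullet> w = (\<Sum>j<n. b j * (x j \<bullet> w)) / real n" .
    have "(\<Sum>k<n. (row A k \<bullet> w) * (row A k \<bullet> w)) = (\<Sum>k<n. r k * (x k \<bullet> w)\<^sup>2)"
      using x r w by (intro sum.cong) (simp_all add: row smult_scalar_prod_distrib[of _ d] power2_eq_square)
    then have Hw: "w \<bullet> (H *\<^sub>v w) = (\<Sum>k<n. r k * (x k \<bullet> w)\<^sup>2) / real n + \<gamma> * (w \<bullet> w)"
      unfolding H_def ridge_hessian_form[OF A w w] by simp
    have "(\<Sum>j<n. l j (x j \<bullet> w))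
        = (\<Sum>j<n. r j * (x j \<bullet> w)\<^sup>2) / 2 + (\<Sum>j<n. b j * (x j \<bullet> w)) + (\<Sum>j<n. c j)"
      by (simp add: l_eq sum.distrib sum_divide_distrib)
    then show ?thesis
      unfolding objective_def norm2_def gw Hw using scalar_prod_self_nonneg[of w]
      by (simp add: add_divide_distrib)
  qed
  then have "quadratic_objective d (objective n x l \<gamma>) H g ((\<Sum>j<n. c j) / real n) \<gamma>"
    using ridge_hessian_carrier[OF A] transpose_ridge_hessian[OF A] ridge_hessian_ge[OF A] \<open>0 < \<gamma>\<close>
    unfolding H_def by unfold_locales (auto simp: g_def)
  then show "\<exists>g c. quadratic_objective d (objective n x l \<gamma>) (ridge_hessian \<gamma> (data_mat n d x l)) g c \<gamma>"
    unfolding H_def A_def by blast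
qed

text \<open>The moment order \<open>p\<close> is chosen as \<open>max 1 (ln (D / \<delta>))\<close> up to rounding, which turns the
  moment bound into an exponential tail.\<close>

lemma sample_size_suffices:
  fixes D M \<epsilon> \<delta> :: real and s :: nat
  defines "L \<equiv> max 1 (ln (D / \<delta>))"
  assumes "0 \<le> M" "0 \<le> D" "0 < \<epsilon>" "\<epsilon> < 1 / 4" "0 < \<delta>" "0 < s"
    and size: "480 * (M / \<epsilon>\<^sup>2) * L \<le> real s"
  obtains p :: nat where "0 < p" "4 * real p * M / real s \<le> 1"
    "(5 * (4 * real p * M / real s) / (\<epsilon> / 2)\<^sup>2) ^ p * D \<le> \<delta>"
proof -
  \<comment> \<open>Because \<open>1 \<le> L\<close>, rounding up at most doubles.\<close>
  define p where "p = nat \<lceil>L\<rceil>"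
  define b where "b = 4 * real p * M / real s"
  have "1 \<le> L" unfolding L_def by simp
  then have p: "0 < p" "L \<le> real p" "real p \<le> 2 * L" unfolding p_def by linarith+
  have "0 \<le> b" unfolding b_def using \<open>0 \<le> M\<close> by simp
  have "480 * (L * M) \<le> real s * \<epsilon>\<^sup>2"
    using size \<open>0 < \<epsilon>\<close> by (simp add: field_simps)
  moreover have "real p * M \<le> 2 * L * M" using p \<open>0 \<le> M\<close> by (intro mult_right_mono)
  ultimately have "240 * (real p * M) \<le> real s * \<epsilon>\<^sup>2" by linarith
  then have b_le: "b \<le> \<epsilon>\<^sup>2 / 60" unfolding b_def using \<open>0 < s\<close> by (simp add: field_simps)
  have "\<epsilon>\<^sup>2 \<le> 1" using \<open>0 < \<epsilon>\<close> \<open>\<epsilon> < 1 / 4\<close> by (intro power_le_one) auto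
  with b_le have "b \<le> 1" by simp
  \<comment> \<open>The left side is \<open>20 * b / \<epsilon>\<^sup>2\<close>. The constant 480
    makes it at most \<open>1 / 3\<close>, hence below \<open>exp (- 1)\<close>, so each moment
    order gains a factor \<open>exp (- 1)\<close>.\<close>
  have ratio: "5 * b / (\<epsilon> / 2)\<^sup>2 \<le> 1 / 3"
    using b_le \<open>0 < \<epsilon>\<close> by (simp add: power_divide field_simps)
  have "exp 1 \<le> (3 :: real)" using exp_le by simp
  then have "1 / 3 \<le> exp (- 1 :: real)" by (simp add: exp_minus field_simps)
  with ratio have "5 * b / (\<epsilon> / 2)\<^sup>2 \<le> exp (- 1)" by simp
  then have "(5 * b / (\<epsilon> / 2)\<^sup>2) ^ p \<le> exp (- 1) ^ p"
    using \<open>0 \<le> b\<close> by (intro power_mono) auto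
  also have "\<dots> = exp (- real p)" by (simp add: exp_of_nat_mult[symmetric])
  also have "\<dots> \<le> exp (- L)" using p by simp
  finally have tail: "(5 * b / (\<epsilon> / 2)\<^sup>2) ^ p * D \<le> exp (- L) * D"
    using \<open>0 \<le> D\<close> by (rule mult_right_mono)
  have "exp (- L) * D \<le> \<delta>"
  proof (cases "D = 0")
    case False
    then have "0 < D" using \<open>0 \<le> D\<close> by simp
    have "exp (- L) \<le> exp (- ln (D / \<delta>))" unfolding L_def by simp
    also have "\<dots> = \<delta> / D" using \<open>0 < D\<close> \<open>0 < \<delta>\<close> by (simp add: exp_minus)
    finally show ?thesis using \<open>0 < D\<close> by (simp add: field_simps)
  qed (use \<open>0 < \<delta>\<close> in simp)
  with tail that[OF p(1)] \<open>b \<le> 1\<close> show ?thesis unfolding b_def by linarith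
qed

(* log(d_eff/delta) is read as max 1 (log(d_eff/delta)): the bare logarithm is non-positive for
   d_eff <= delta and may be arbitrarily close to 0 otherwise, and then the claim is false. *)
theorem theorem1:
  shows "\<exists>C>0::real. \<forall>(n::nat) (d::nat) (s::nat) (x :: nat \<Rightarrow> real vec) (l :: nat \<Rightarrow> real \<Rightarrow> real)
            (\<gamma>::real) (\<epsilon>::real) (\<delta>::real) (w0 :: real vec).
     let A = data_mat n d x l;
         H = ridge_hessian \<gamma> A;
         F = objective n x l \<gamma>
     in
       1 \<le> n \<longrightarrow> 1 \<le> d \<longrightarrow> 1 \<le> s \<longrightarrow>
       (\<forall>j<n. x j \<in> carrier_vec d) \<longrightarrow>
       (\<forall>j<n. convex_quadratic (l j)) \<longrightarrow>
       0 < \<gamma> \<longrightarrow>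
       0 < \<epsilon> \<longrightarrow> \<epsilon> < 1/4 \<longrightarrow>
       0 < \<delta> \<longrightarrow> \<delta> < 1 \<longrightarrow>
       w0 \<in> carrier_vec d \<longrightarrow>
       real s \<ge> C * (ridge_coherence \<gamma> A * eff_dim \<gamma> A / \<epsilon>\<^sup>2) * max 1 (ln (eff_dim \<gamma> A / \<delta>)) \<longrightarrow>
         (\<forall>w\<in>carrier_vec d. hessian d F w = H) \<and>
         (\<exists>!w. is_arg_min F (\<lambda>w. w \<in> carrier_vec d) w) \<and>
         (\<forall>ws. is_arg_min F (\<lambda>w. w \<in> carrier_vec d) ws \<longrightarrow>
            measure_pmf.prob (uniform_sampling n s)
              {\<omega>. \<forall>t. norm2 (newton_iter d F (ridge_hessian \<gamma> (sample_rows A s \<omega>)) w0 t - ws)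
                      \<le> \<epsilon> ^ t * sqrt (cond_number H) * norm2 (w0 - ws)}
            \<ge> 1 - \<delta>)"
  unfolding Let_def
\<comment> \<open>The constant is the one of \<open>sample_size_suffices\<close>.\<close>
proof (intro exI[of _ 480] conjI allI impI)
  fix n d s :: nat and x :: "nat \<Rightarrow> real vec" and l :: "nat \<Rightarrow> real \<Rightarrow> real"
    and \<gamma> \<epsilon> \<delta> :: real and w0 :: "real vec"
  define A where "A = data_mat n d x l"
  define H where "H = ridge_hessian \<gamma> A"
  define F where "F = objective n x l \<gamma>"
  assume n: "1 \<le> n" and d: "1 \<le> d" and s: "1 \<le> s" and x: "\<forall>j<n. x j \<in> carrier_vec d"
    and l: "\<forall>j<n. convex_quadratic (l j)" and \<gamma>: "0 < \<gamma>" and \<epsilon>: "0 < \<epsilon>" "\<epsilon> < 1/4"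
    and \<delta>: "0 < \<delta>" "\<delta> < 1" and w0: "w0 \<in> carrier_vec d"
    and size: "480 * (ridge_coherence \<gamma> (data_mat n d x l) * eff_dim \<gamma> (data_mat n d x l) / \<epsilon>\<^sup>2)
      * max 1 (ln (eff_dim \<gamma> (data_mat n d x l) / \<delta>)) \<le> real s"
  have A: "A \<in> carrier_mat n d"
    unfolding A_def by (rule quadratic_objective_data_mat(1)[OF x l \<gamma>])
  obtain g c where "quadratic_objective d F H g c \<gamma>"
    using quadratic_objective_data_mat(2)[OF x l \<gamma>] unfolding F_def H_def A_def by blast
  then interpret quadratic_objective d F H g c \<gamma> .
  obtain ws where ws: "ws \<in> carrier_vec d" "H *\<^sub>v ws + g = 0\<^sub>v d"
    and argmin: "\<And>w. is_arg_min F (\<lambda>w. w \<in> carrier_vec d) w \<longleftrightarrow> w = ws"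
    by (rule minimizer) (rule that)
  show "\<forall>w\<in>carrier_vec d. hessian d (objective n x l \<gamma>) w = ridge_hessian \<gamma> (data_mat n d x l)"
    using hessian_eq unfolding F_def H_def A_def by blast
  show "\<exists>!w. is_arg_min (objective n x l \<gamma>) (\<lambda>w. w \<in> carrier_vec d) w"
    using argmin unfolding F_def by auto
  fix ws' assume "is_arg_min (objective n x l \<gamma>) (\<lambda>w. w \<in> carrier_vec d) ws'"
  then have ws': "ws' = ws" using argmin unfolding F_def by simp
  define P where "P \<sigma> \<longleftrightarrow> (\<forall>t. norm2 (newton_iter d F (ridge_hessian \<gamma> (sample_rows A s \<sigma>)) w0 t - ws)
      \<le> \<epsilon> ^ t * sqrt (cond_number H) * norm2 (w0 - ws))" for \<sigma>
  \<comment> \<open>Relative accuracy \<open>\<epsilon> / 2\<close> controls all iterates at once,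
    which is why a single draw of the sample serves every \<open>t\<close>.\<close>
  have good: "P \<sigma>" if "\<And>u. u \<in> carrier_vec d \<Longrightarrow>
      \<bar>u \<bullet> (ridge_hessian \<gamma> (sample_rows A s \<sigma>) *\<^sub>v u) - u \<bullet> (ridge_hessian \<gamma> A *\<^sub>v u)\<bar>
        \<le> \<epsilon> / 2 * (u \<bullet> (ridge_hessian \<gamma> A *\<^sub>v u))" for \<sigma>
  proof -
    have "sample_rows A s \<sigma> \<in> carrier_mat s d" unfolding sample_rows_def using A by auto
    then show ?thesis
      unfolding P_def using that d
      by (intro allI newton_iter_error[OF _ _ _ \<epsilon> _ ws w0])
        (auto simp: H_def intro: ridge_hessian_carrier transpose_ridge_hessian)
  qed
  have "0 < n" "0 < s" using n s by auto
  note close = prob_ridge_hessian_close[OF A \<open>0 < n\<close> \<open>0 < s\<close> \<gamma>]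
  obtain p :: nat where p: "0 < p" "4 * real p * (ridge_coherence \<gamma> A * eff_dim \<gamma> A) / real s \<le> 1"
    "(5 * (4 * real p * (ridge_coherence \<gamma> A * eff_dim \<gamma> A) / real s) / (\<epsilon> / 2)\<^sup>2) ^ p * eff_dim \<gamma> A \<le> \<delta>"
    using sample_size_suffices[OF close(1,2) \<epsilon> \<delta>(1) \<open>0 < s\<close>] size unfolding A_def by metis
  have "1 - (5 * (4 * real p * (ridge_coherence \<gamma> A * eff_dim \<gamma> A) / real s) / (\<epsilon> / 2)\<^sup>2) ^ p * eff_dim \<gamma> A
      \<le> measure_pmf.prob (uniform_sampling n s) {\<sigma>. P \<sigma>}"
    using \<epsilon> by (intro close(3) p good) auto
  with p(3) have "1 - \<delta> \<le> measure_pmf.prob (uniform_sampling n s) {\<sigma>. P \<sigma>}" by linarith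
  then show "1 - \<delta> \<le> measure_pmf.prob (uniform_sampling n s)
      {\<omega>. \<forall>t. norm2 (newton_iter d (objective n x l \<gamma>)
          (ridge_hessian \<gamma> (sample_rows (data_mat n d x l) s \<omega>)) w0 t - ws')
        \<le> \<epsilon> ^ t * sqrt (cond_number (ridge_hessian \<gamma> (data_mat n d x l))) * norm2 (w0 - ws')}"
    unfolding P_def F_def H_def A_def ws' .
qed simp

end
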